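(* Let $X$ be a rearrangement invariant space over $(-1,1)$ satisfying $0<\underline{\alpha}_X\le\overline{\alpha}_X<1$. The operator $T_X\colon X\to X$ is neither completely continuous nor order bounded. In particular, $T_X$ is not a compact operator.
   Context: Let $\mu$ be Lebesgue measure on the Borel $\sigma$-algebra $\mathscr{B}$ of $(-1,1)$, let $\mathrm{sim}\,\mathscr{B}$ be the space of all $\mathbb{C}$-valued $\mathscr{B}$-simple functions, and let $L^0$ be the complex vector lattice of all $\mathbb{C}$-valued $\mathscr{B}$-measurable functions on $(-1,1)$ (functions equal a.e. are identified). $L^p$ means $L^p(-1,1)$. A Banach function space (B.f.s.) over $(-1,1)$ is an order ideal $X$ of $L^0$ with $\mathrm{sim}\,\mathscr{B}\subseteq X$, equipped with a lattice norm $\|\cdot\|_X$ for which $X$ is complete. It has the Fatou property if, whenever $\{f_n\}$ is a norm-bounded increasing sequence of positive functions in $X$ with $f=\sup_n f_n$ in $L^0$, then $f\in X$ and $\|f_n\|_X\to\|f\|_X$. For $f\in L^0$ the decreasing rearrangement $f^*\colon[0,2]\to[0,\infty]$ is the right continuous inverse of the distribution function $\lambda\mapsto\mu(\{|f|>\lambda\})$. A B.f.s. $X$ over $(-1,1)$ with the Fatou property is rearrangement invariant (r.i.) if $g\in L^0$ and $g^*\le f^*$ for some $f\in X$ imply $g\in X$. Then $L^\infty\subseteq X\subseteq L^1$ continuously. For $t>0$ the dilation operator $E_t\colon X\to X$ is $E_t(f)(x)=f(tx)$ if $-1<tx<1$ and $0$ otherwise. The Boyd indices are $\underline{\alpha}_X=\sup_{0<t<1}\frac{\log\|E_{1/t}\|_{\mathrm{op}}}{\log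 t}$ and $\overline{\alpha}_X=\inf_{1<t<\infty}\frac{\log\|E_{1/t}\|_{\mathrm{op}}}{\log t}$. The finite Hilbert transform of $f\in L^1$ is $T(f)(t)=\lim_{\varepsilon\to0+}\frac1\pi\left(\int_{-1}^{t-\varepsilon}+\int_{t+\varepsilon}^1\right)\frac{f(x)}{x-t}\,dx$, which exists for a.e. $t\in(-1,1)$; $T(f)\in L^0$. If $X$ is r.i. with $0<\underline{\alpha}_X\le\overline{\alpha}_X<1$, then $T$ maps $X$ boundedly into $X$ and $T_X\colon X\to X$ denotes this operator. A bounded linear operator between Banach spaces is completely continuous if it maps relatively weakly compact sets to relatively compact sets. A linear operator between Banach lattices is order bounded if it maps order bounded sets to order bounded sets, where $W\subseteq X$ is order bounded if there is $0\le h\in X$ with $|f|\le h$ a.e. for all $f\in W$. *)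

theory Defs
  imports "HOL-Analysis.Analysis"
begin

text \<open>
  Elements of \<open>L\<^sup>0\<close> are handled through representatives: a space of a.e.-classes over
  \<open>(-1,1)\<close> is a set \<open>X\<close> of functions which is saturated under a.e. equality (a consequence of
  solidity), and its norm is a function \<open>N\<close> on representatives that is constant on classes (a
  consequence of monotonicity). Values outside \<open>(-1,1)\<close> are irrelevant throughout.
\<close>

definition \<mu> :: "real measure" where
  "\<mu> = restrict_space lborel {-1<..<1}"

abbreviation L0 :: "(real \<Rightarrow> complex) set" where
  "L0 \<equiv> borel_measurable \<mu>"

definition order_ideal :: "(real \<Rightarrow> complex) set \<Rightarrow> bool" where
  "order_ideal X \<longleftrightarrow>
     X \<subseteq> L0 \<and> (\<lambda>x. 0) \<in> X \<and>
     (\<forall>f\<in>X. \<forall>g\<in>X. (\<lambda>x. f x + g x) \<in> X) \<and>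
     (\<forall>c. \<forall>f\<in>X. (\<lambda>x. c * f x) \<in> X) \<and>
     (\<forall>f\<in>X. \<forall>g\<in>L0. (AE x in \<mu>. cmod (g x) \<le> cmod (f x)) \<longrightarrow> g \<in> X)"

definition lattice_norm_on :: "(real \<Rightarrow> complex) set \<Rightarrow> ((real \<Rightarrow> complex) \<Rightarrow> real) \<Rightarrow> bool" where
  "lattice_norm_on X N \<longleftrightarrow>
     (\<forall>f\<in>X. 0 \<le> N f \<and> (N f = 0 \<longleftrightarrow> (AE x in \<mu>. f x = 0))) \<and>
     (\<forall>f\<in>X. \<forall>g\<in>X. N (\<lambda>x. f x + g x) \<le> N f + N g) \<and>
     (\<forall>c. \<forall>f\<in>X. N (\<lambda>x. c * f x) = cmod c * N f) \<and>
     (\<forall>f\<in>X. \<forall>g\<in>X. (AE x in \<mu>. cmod (g x) \<le> cmod (f x)) \<longrightarrow> N g \<le> N f)"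

definition norm_complete :: "(real \<Rightarrow> complex) set \<Rightarrow> ((real \<Rightarrow> complex) \<Rightarrow> real) \<Rightarrow> bool" where
  "norm_complete X N \<longleftrightarrow>
     (\<forall>u :: nat \<Rightarrow> real \<Rightarrow> complex. (\<forall>n. u n \<in> X) \<longrightarrow>
        (\<forall>e>0. \<exists>K. \<forall>m\<ge>K. \<forall>n\<ge>K. N (\<lambda>x. u m x - u n x) < e) \<longrightarrow>
        (\<exists>f\<in>X. (\<lambda>n. N (\<lambda>x. u n x - f x)) \<longlonglongrightarrow> 0))"

definition banach_function_space ::
    "(real \<Rightarrow> complex) set \<Rightarrow> ((real \<Rightarrow> complex) \<Rightarrow> real) \<Rightarrow> bool" where
  "banach_function_space X N \<longleftrightarrow>
     order_ideal X \<and> {f. simple_function \<mu> f} \<subseteq> X \<and> lattice_norm_on X N \<and> norm_complete X N"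

text \<open>
  Positive elements are written as real-valued functions. The supremum is taken in \<open>ereal\<close>, so that
  the condition on \<open>v\<close> says that the a.e. pointwise supremum is finite a.e. and equal to \<open>v\<close>.
\<close>

definition fatou_property ::
    "(real \<Rightarrow> complex) set \<Rightarrow> ((real \<Rightarrow> complex) \<Rightarrow> real) \<Rightarrow> bool" where
  "fatou_property X N \<longleftrightarrow>
     (\<forall>(u :: nat \<Rightarrow> real \<Rightarrow> real) (v :: real \<Rightarrow> real).
        (\<forall>n. (\<lambda>x. complex_of_real (u n x)) \<in> X) \<longrightarrow>
        (\<forall>n. AE x in \<mu>. 0 \<le> u n x \<and> u n x \<le> u (Suc n) x) \<longrightarrow>
        (\<exists>B. \<forall>n. N (\<lambda>x. complex_of_real (u n x)) \<le> B) \<longrightarrow>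
        v \<in> borel_measurable \<mu> \<longrightarrow>
        (AE x in \<mu>. ereal (v x) = (SUP n. ereal (u n x))) \<longrightarrow>
        (\<lambda>x. complex_of_real (v x)) \<in> X \<and>
        (\<lambda>n. N (\<lambda>x. complex_of_real (u n x))) \<longlonglongrightarrow> N (\<lambda>x. complex_of_real (v x)))"

definition distribution_function :: "(real \<Rightarrow> complex) \<Rightarrow> real \<Rightarrow> real" where
  "distribution_function f l = measure \<mu> {x \<in> space \<mu>. l < cmod (f x)}"

text \<open>
  The right continuous inverse of the distribution function. The infimum over the empty set
  (possible only for \<open>s = 0\<close>) is \<open>\<infinity>\<close>.
\<close>

definition decreasing_rearrangement :: "(real \<Rightarrow> complex) \<Rightarrow> real \<Rightarrow> ennreal" where
  "decreasing_rearrangement f s = (INF l\<in>{l. 0 \<le> l \<and> distribution_function f l \<le> s}. ennreal l)"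

definition rearrangement_invariant ::
    "(real \<Rightarrow> complex) set \<Rightarrow> ((real \<Rightarrow> complex) \<Rightarrow> real) \<Rightarrow> bool" where
  "rearrangement_invariant X N \<longleftrightarrow>
     banach_function_space X N \<and> fatou_property X N \<and>
     (\<forall>f\<in>X. \<forall>g\<in>L0.
        (\<forall>s\<in>{0..2}. decreasing_rearrangement g s \<le> decreasing_rearrangement f s) \<longrightarrow> g \<in> X)"

definition dilation :: "real \<Rightarrow> (real \<Rightarrow> complex) \<Rightarrow> real \<Rightarrow> complex" where
  "dilation t f x = (if -1 < t * x \<and> t * x < 1 then f (t * x) else 0)"

text \<open>
  The supremum is the operator norm only for bounded operators. It is applied below to dilations,
  which are positive, hence bounded, operators on every rearrangement invariant space.
\<close>

definition op_norm :: "(real \<Rightarrow> complex) set \<Rightarrow> ((real \<Rightarrow> complex) \<Rightarrow> real) \<Rightarrow>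
    ((real \<Rightarrow> complex) \<Rightarrow> (real \<Rightarrow> complex)) \<Rightarrow> real" where
  "op_norm X N S = (SUP f\<in>{f \<in> X. N f \<le> 1}. N (S f))"

definition lower_boyd_index ::
    "(real \<Rightarrow> complex) set \<Rightarrow> ((real \<Rightarrow> complex) \<Rightarrow> real) \<Rightarrow> ereal" where
  "lower_boyd_index X N = (SUP t\<in>{0<..<1}. ereal (ln (op_norm X N (dilation (1 / t))) / ln t))"

definition upper_boyd_index ::
    "(real \<Rightarrow> complex) set \<Rightarrow> ((real \<Rightarrow> complex) \<Rightarrow> real) \<Rightarrow> ereal" where
  "upper_boyd_index X N = (INF t\<in>{1<..}. ereal (ln (op_norm X N (dilation (1 / t))) / ln t))"

definition finite_hilbert_transform :: "(real \<Rightarrow> complex) \<Rightarrow> real \<Rightarrow> complex" where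
  "finite_hilbert_transform f t =
     Lim (at_right 0) (\<lambda>\<epsilon>. complex_of_real (1 / pi) *
       ((LBINT x:{-1<..<t - \<epsilon>}. f x / complex_of_real (x - t)) +
        (LBINT x:{t + \<epsilon><..<1}. f x / complex_of_real (x - t))))"

text \<open>
  The topologies live on representatives, so they are not Hausdorff: they are the inverse images
  of the topologies of the space of classes. Compactness of closures is not affected by this.
\<close>

definition norm_topology ::
    "(real \<Rightarrow> complex) set \<Rightarrow> ((real \<Rightarrow> complex) \<Rightarrow> real) \<Rightarrow> (real \<Rightarrow> complex) topology" where
  "norm_topology X N =
     topology_generated_by {{g \<in> X. N (\<lambda>x. g x - f x) < e} | f e. f \<in> X \<and> 0 < e}"

definition bounded_linear_functional :: "(real \<Rightarrow> complex) set \<Rightarrow> ((real \<Rightarrow> complex) \<Rightarrow> real) \<Rightarrow>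
    ((real \<Rightarrow> complex) \<Rightarrow> complex) \<Rightarrow> bool" where
  "bounded_linear_functional X N \<phi> \<longleftrightarrow>
     (\<forall>f\<in>X. \<forall>g\<in>X. \<phi> (\<lambda>x. f x + g x) = \<phi> f + \<phi> g) \<and>
     (\<forall>c. \<forall>f\<in>X. \<phi> (\<lambda>x. c * f x) = c * \<phi> f) \<and>
     (\<exists>C. \<forall>f\<in>X. cmod (\<phi> f) \<le> C * N f)"

definition weak_topology_on ::
    "(real \<Rightarrow> complex) set \<Rightarrow> ((real \<Rightarrow> complex) \<Rightarrow> real) \<Rightarrow> (real \<Rightarrow> complex) topology" where
  "weak_topology_on X N =
     topology_generated_by {{f \<in> X. \<phi> f \<in> U} | \<phi> U. bounded_linear_functional X N \<phi> \<and> open U}"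

definition relatively_compactin :: "'a topology \<Rightarrow> 'a set \<Rightarrow> bool" where
  "relatively_compactin \<tau> W \<longleftrightarrow> compactin \<tau> (\<tau> closure_of W)"

text \<open>
  The following notions are meant for operators that map \<open>X\<close> linearly and boundedly into \<open>X\<close>.
  This is not part of the definitions, so that their negations do not merely deny it; in
  particular, \<open>\<tau> closure_of W\<close> disregards points of \<open>W\<close> outside \<open>topspace \<tau>\<close>.
\<close>

definition completely_continuous :: "(real \<Rightarrow> complex) set \<Rightarrow> ((real \<Rightarrow> complex) \<Rightarrow> real) \<Rightarrow>
    ((real \<Rightarrow> complex) \<Rightarrow> (real \<Rightarrow> complex)) \<Rightarrow> bool" where
  "completely_continuous X N S \<longleftrightarrow>
     (\<forall>W\<subseteq>X. relatively_compactin (weak_topology_on X N) W \<longrightarrow>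
        relatively_compactin (norm_topology X N) (S ` W))"

definition compact_operator :: "(real \<Rightarrow> complex) set \<Rightarrow> ((real \<Rightarrow> complex) \<Rightarrow> real) \<Rightarrow>
    ((real \<Rightarrow> complex) \<Rightarrow> (real \<Rightarrow> complex)) \<Rightarrow> bool" where
  "compact_operator X N S \<longleftrightarrow>
     (\<forall>W\<subseteq>X. (\<exists>B. \<forall>f\<in>W. N f \<le> B) \<longrightarrow> relatively_compactin (norm_topology X N) (S ` W))"

definition order_bounded :: "(real \<Rightarrow> complex) set \<Rightarrow> (real \<Rightarrow> complex) set \<Rightarrow> bool" where
  "order_bounded X W \<longleftrightarrow>
     (\<exists>h :: real \<Rightarrow> real. (\<lambda>x. complex_of_real (h x)) \<in> X \<and> (AE x in \<mu>. 0 \<le> h x) \<and>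
        (\<forall>f\<in>W. AE x in \<mu>. cmod (f x) \<le> h x))"

definition order_bounded_operator :: "(real \<Rightarrow> complex) set \<Rightarrow>
    ((real \<Rightarrow> complex) \<Rightarrow> (real \<Rightarrow> complex)) \<Rightarrow> bool" where
  "order_bounded_operator X S \<longleftrightarrow>
     (\<forall>W\<subseteq>X. order_bounded X W \<longrightarrow> order_bounded X (S ` W))"

end

theory Submission
  imports Defs
begin

text \<open>
  Everything is tested on the functions \<open>sin (n * arccos x)\<close>, which the finite Hilbert transform
  sends to \<open>- cos (n * arccos x)\<close>, that is, to minus the Chebyshev polynomials
  (\<open>finite_hilbert_transform_sin_arccos\<close>). Both families consist of functions bounded by 1.

  The functions \<open>sin (n * arccos x)\<close> tend to 0 weakly in \<open>X\<close>
  (\<open>trig_fun_weakly_null\<close>). Indeed, if \<open>\<bar>\<phi> (f n)\<bar> \<ge> \<delta>\<close> held for infinitely many \<open>n\<close> and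
  some bounded functional \<open>\<phi>\<close>, then averages of the \<open>f n\<close> with unimodular coefficients would keep
  \<open>\<bar>\<phi>\<bar> \<ge> \<delta>\<close>. By orthogonality such averages are small in \<open>L\<^sup>2\<close>; being bounded by 1,
  they are small off a set of small measure, and therefore small in \<open>X\<close> once indicators of small sets
  have small norm.

  That indicators of small sets have small norm (\<open>norm_indicator_small\<close>) is where the lower Boyd
  index enters. If it is positive, some dilation shrinking supports by a factor \<open>t < 1\<close> has norm
  below 1, so the indicators of \<open>(-t ^ k, t ^ k)\<close> have geometrically decreasing norm. The norm itself
  need not be invariant under rearrangement, only membership in \<open>X\<close> is. The passage from these intervals
  to arbitrary sets is a gliding hump argument: sets \<open>A k\<close> shrinking quickly, with the norms of their
  indicators bounded below, would yield \<open>\<Sum>k. 2 ^ k * indicator (A k)\<close> in \<open>X\<close>, since its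
  rearrangement lies below that of an element of \<open>X\<close>, but with infinite norm.

  The images \<open>cos (n * arccos x)\<close> are not totally bounded (\<open>cos_not_totally_bounded\<close>). If they
  were, infinitely many of them would lie in one small ball; their averages are small, so they would have
  small norm themselves, hence also their squares; but \<open>1 = 2 * (cos \<theta>)\<^sup>2 - cos (2 * \<theta>)\<close>, and
  averaging this identity would make the norm of 1 small. So the transform maps a bounded, relatively weakly
  compact set to a set which is not relatively compact, which rules out both complete continuity and
  compactness.

  Order boundedness fails already on the order interval of functions bounded by 1: the transform of the
  indicator of \<open>(-1, b)\<close> at \<open>t > b\<close> is \<open>(ln (t - b) - ln (t + 1)) / pi\<close>, so every
  common majorant of these transforms, over rational \<open>b\<close>, is infinite almost everywhere.
\<close>

section \<open>The measure space \<open>(-1,1)\<close>\<close>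

lemma space_\<mu> [simp]: "space \<mu> = {-1<..<1}"
  by (simp add: \<mu>_def space_restrict_space)

lemma sets_\<mu>_iff: "A \<in> sets \<mu> \<longleftrightarrow> A \<in> sets borel \<and> A \<subseteq> {-1<..<1}"
  by (auto simp: \<mu>_def sets_restrict_space_iff)

lemma emeasure_\<mu>: "A \<in> sets \<mu> \<Longrightarrow> emeasure \<mu> A = emeasure lborel A"
  unfolding \<mu>_def by (subst emeasure_restrict_space) (auto simp: sets_restrict_space_iff)

lemma measure_\<mu>: "A \<in> sets \<mu> \<Longrightarrow> measure \<mu> A = measure lborel A"
  by (simp add: measure_def emeasure_\<mu>)

lemma finite_measure_\<mu>: "finite_measure \<mu>"
proof (rule finite_measureI)
  have "emeasure \<mu> (space \<mu>) = emeasure lborel {-1<..<1::real}"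
    by (subst emeasure_\<mu>) (auto simp: sets_\<mu>_iff)
  then show "emeasure \<mu> (space \<mu>) \<noteq> \<infinity>" by simp
qed

lemma AE_\<mu>_iff: "(AE x in \<mu>. P x) \<longleftrightarrow> (AE x in lborel. x \<in> {-1<..<1} \<longrightarrow> P x)"
  unfolding \<mu>_def by (rule AE_restrict_space_iff) auto

lemma AE_\<mu>_I: "(\<And>x. -1 < x \<Longrightarrow> x < 1 \<Longrightarrow> P x) \<Longrightarrow> AE x in \<mu>. P x"
  by (rule AE_I2) auto

lemma AE_\<mu>_False: "\<not> (AE x in \<mu>. False)"
proof
  assume "AE x in \<mu>. False"
  then have "emeasure \<mu> (space \<mu>) = 0"
    using emeasure_eq_0_AE[of "\<lambda>x. True" \<mu>] by (simp del: space_\<mu>)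
  moreover have "emeasure \<mu> (space \<mu>) = emeasure lborel {-1<..<1::real}"
    by (subst emeasure_\<mu>) (auto simp: sets_\<mu>_iff)
  ultimately show False by simp
qed

lemma continuous_on_L0:
  fixes f :: "real \<Rightarrow> complex"
  assumes "continuous_on {-1..1} f"
  shows "f \<in> L0"
proof -
  have "f \<in> borel_measurable (restrict_space borel {-1<..<1})"
    by (rule borel_measurable_continuous_on_restrict)
       (rule continuous_on_subset[OF assms], auto)
  then show ?thesis
    unfolding \<mu>_def by (simp cong: measurable_cong_sets add: sets_restrict_space)
qed

section \<open>Banach function spaces\<close>

locale bfs =
  fixes X :: "(real \<Rightarrow> complex) set" and N :: "(real \<Rightarrow> complex) \<Rightarrow> real"
  assumes bfs: "banach_function_space X N"
begin

lemma ideal: "order_ideal X" and simple_X: "{f. simple_function \<mu> f} \<subseteq> X"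
  and lattice_norm: "lattice_norm_on X N" and complete: "norm_complete X N"
  using bfs by (auto simp: banach_function_space_def)

lemma X_L0: "f \<in> X \<Longrightarrow> f \<in> L0"
  and X_zero: "(\<lambda>x. 0) \<in> X"
  and X_add: "f \<in> X \<Longrightarrow> g \<in> X \<Longrightarrow> (\<lambda>x. f x + g x) \<in> X"
  and X_scale: "f \<in> X \<Longrightarrow> (\<lambda>x. c * f x) \<in> X"
  and X_solid: "f \<in> X \<Longrightarrow> g \<in> L0 \<Longrightarrow> (AE x in \<mu>. cmod (g x) \<le> cmod (f x)) \<Longrightarrow> g \<in> X"
  using ideal unfolding order_ideal_def by blast+

lemma N_nonneg: "f \<in> X \<Longrightarrow> 0 \<le> N f"
  and N_eq_0: "f \<in> X \<Longrightarrow> N f = 0 \<longleftrightarrow> (AE x in \<mu>. f x = 0)"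
  and N_triangle: "f \<in> X \<Longrightarrow> g \<in> X \<Longrightarrow> N (\<lambda>x. f x + g x) \<le> N f + N g"
  and N_scale: "f \<in> X \<Longrightarrow> N (\<lambda>x. c * f x) = cmod c * N f"
  and N_mono: "f \<in> X \<Longrightarrow> g \<in> X \<Longrightarrow> (AE x in \<mu>. cmod (g x) \<le> cmod (f x)) \<Longrightarrow> N g \<le> N f"
  using lattice_norm unfolding lattice_norm_on_def by blast+

lemma X_diff: "f \<in> X \<Longrightarrow> g \<in> X \<Longrightarrow> (\<lambda>x. f x - g x) \<in> X"
  using X_add[of f "\<lambda>x. (-1) * g x"] X_scale[of g "-1"] by simp

lemma N_diff: "f \<in> X \<Longrightarrow> g \<in> X \<Longrightarrow> N (\<lambda>x. f x - g x) \<le> N f + N g"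
  using N_triangle[of f "\<lambda>x. (-1) * g x"] X_scale[of g "-1"] N_scale[of g "-1"] by simp

lemma N_minus_commute:
  assumes "f \<in> X" "g \<in> X" shows "N (\<lambda>x. f x - g x) = N (\<lambda>x. g x - f x)"
  using N_scale[OF X_diff[OF assms], of "-1"] by simp

lemma N_zero: "N (\<lambda>x. 0) = 0"
  using N_eq_0[OF X_zero] by simp

lemma X_cong:
  assumes "f \<in> X" "g \<in> L0" "AE x in \<mu>. g x = f x"
  shows "g \<in> X" "N g = N f"
proof -
  show g: "g \<in> X"
    by (rule X_solid[OF assms(1,2)]) (use assms(3) in \<open>eventually_elim, simp\<close>)
  show "N g = N f"
    by (intro antisym N_mono g assms(1); use assms(3) in \<open>eventually_elim, simp\<close>)
qed

lemma X_const: "(\<lambda>x. c) \<in> X"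
  using simple_X by auto

lemma X_bounded:
  assumes "f \<in> L0" "\<And>x. -1 < x \<Longrightarrow> x < 1 \<Longrightarrow> cmod (f x) \<le> C"
  shows "f \<in> X"
proof (rule X_solid[OF X_const assms(1)])
  show "AE x in \<mu>. cmod (f x) \<le> cmod (complex_of_real C)"
    by (rule AE_\<mu>_I) (use assms(2) order_trans[OF norm_ge_zero assms(2)] in force)
qed

lemma X_indicator: "A \<in> sets \<mu> \<Longrightarrow> (indicator A :: real \<Rightarrow> complex) \<in> X"
  by (rule X_bounded[where C = 1]) (auto simp: indicator_def intro: borel_measurable_indicator)

lemma X_sum: "(\<And>i. i \<in> I \<Longrightarrow> u i \<in> X) \<Longrightarrow> (\<lambda>x. \<Sum>i\<in>I. u i x) \<in> X"
  by (induction I rule: infinite_finite_induct) (auto intro: X_zero X_add)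

lemma N_sum:
  assumes "finite I" "\<And>i. i \<in> I \<Longrightarrow> u i \<in> X"
  shows "N (\<lambda>x. \<Sum>i\<in>I. u i x) \<le> (\<Sum>i\<in>I. N (u i))"
  using assms
proof (induction I rule: finite_induct)
  case empty
  then show ?case by (simp add: N_zero)
next
  case (insert i I)
  then show ?case
    using N_triangle[OF _ X_sum, of "u i" I u] by simp
qed

lemma X_abs:
  assumes "f \<in> X" shows "(\<lambda>x. complex_of_real (cmod (f x))) \<in> X" and
    "N (\<lambda>x. complex_of_real (cmod (f x))) = N f"
proof -
  note [measurable] = X_L0[OF assms]
  show *: "(\<lambda>x. complex_of_real (cmod (f x))) \<in> X"
    by (rule X_solid[OF assms]) auto
  show "N (\<lambda>x. complex_of_real (cmod (f x))) = N f"
    by (intro antisym N_mono assms *) auto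
qed

lemma N_one_pos: "0 < N (\<lambda>x. 1)"
proof -
  have "N (\<lambda>x. 1) \<noteq> 0"
    using N_eq_0[OF X_const[of 1]] AE_\<mu>_False by simp
  then show ?thesis
    using N_nonneg[OF X_const[of 1]] by simp
qed

lemma N_const_bound:
  assumes "f \<in> X" "\<And>x. -1 < x \<Longrightarrow> x < 1 \<Longrightarrow> cmod (f x) \<le> C"
  shows "N f \<le> C * N (\<lambda>x. 1)"
proof -
  have "0 \<le> C" using order_trans[OF norm_ge_zero assms(2)[of 0]] by simp
  have "N f \<le> N (\<lambda>x. complex_of_real C)"
    by (rule N_mono[OF X_const assms(1)], rule AE_\<mu>_I) (use assms(2) \<open>0 \<le> C\<close> in force)
  also have "\<dots> = C * N (\<lambda>x. 1)"
    using N_scale[OF X_const[of 1], of "complex_of_real C"] \<open>0 \<le> C\<close> by simp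
  finally show ?thesis .
qed

lemma N_average_le:
  assumes K: "finite K" "K \<noteq> {}" and u: "\<And>k. k \<in> K \<Longrightarrow> u k \<in> X" "\<And>k. k \<in> K \<Longrightarrow> N (u k) \<le> B"
  shows "N (\<lambda>x. complex_of_real (1 / card K) * (\<Sum>k\<in>K. u k x)) \<le> B"
proof -
  have sX: "(\<lambda>x. \<Sum>k\<in>K. u k x) \<in> X" by (rule X_sum[OF u(1)])
  have "N (\<lambda>x. \<Sum>k\<in>K. u k x) \<le> (\<Sum>k\<in>K. N (u k))" by (rule N_sum[OF K(1) u(1)])
  also have "\<dots> \<le> (\<Sum>k\<in>K. B)" by (intro sum_mono u(2))
  finally have *: "N (\<lambda>x. \<Sum>k\<in>K. u k x) \<le> card K * B" by simp
  have "N (\<lambda>x. complex_of_real (1 / card K) * (\<Sum>k\<in>K. u k x)) = 1 / card K * N (\<lambda>x. \<Sum>k\<in>K. u k x)"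
    using N_scale[OF sX, of "complex_of_real (1 / card K)"] by (simp add: norm_divide)
  also have "\<dots> \<le> 1 / card K * (card K * B)" using * by (intro mult_left_mono) auto
  also have "\<dots> = B" using K by simp
  finally show ?thesis .
qed

text \<open>
  The one use of completeness. The partial sums of \<open>\<Sum>n. \<bar>u n\<bar>\<close> form a Cauchy sequence; their
  limit dominates every term because, for a lattice norm, the excess of a term over the limit has norm
  at most the distance from the later partial sums to the limit. All gliding hump arguments below rest on it.
\<close>

lemma dominating_function:
  fixes u :: "nat \<Rightarrow> real \<Rightarrow> complex"
  assumes u: "\<And>n. u n \<in> X" and small: "\<And>n. N (u n) \<le> c * (1/2) ^ n"
  obtains h where "h \<in> X" "\<And>n. AE x in \<mu>. cmod (u n x) \<le> cmod (h x)"
proof -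
  define a where "a n x = complex_of_real (cmod (u n x))" for n x
  have aX: "a n \<in> X" and Na: "N (a n) = N (u n)" for n
    using X_abs[OF u[of n]] by (simp_all add: a_def[abs_def])
  define S where "S m x = (\<Sum>k<m. a k x)" for m x
  have SX: "S m \<in> X" for m
    unfolding S_def[abs_def] by (rule X_sum) (rule aX)
  have c0: "0 \<le> c"
    using small[of 0] N_nonneg[OF u[of 0]] by simp
  have sum_tail: "(\<Sum>k\<in>{m..<m+j}. (1/2::real)^k) \<le> 2 * (1/2)^m" for m j
  proof -
    have "(\<Sum>k\<in>{m..<m+j}. (1/2::real)^k) = 2 * (1/2)^m - 2 * (1/2)^(m+j)"
      by (induction j) auto
    then show ?thesis by simp
  qed
  have tail: "N (\<lambda>x. S n x - S m x) \<le> 2 * c * (1/2) ^ m" if "m \<le> n" for m n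
  proof -
    have eq: "S n x - S m x = (\<Sum>k\<in>{m..<n}. a k x)" for x
      unfolding S_def using sum_diff_nat_ivl[of 0 m n "\<lambda>k. a k x"] that
      by (simp add: atLeast0LessThan)
    have "N (\<lambda>x. S n x - S m x) \<le> (\<Sum>k\<in>{m..<n}. N (a k))"
      unfolding eq by (rule N_sum) (auto intro: aX)
    also have "\<dots> \<le> (\<Sum>k\<in>{m..<n}. c * (1/2)^k)"
      by (intro sum_mono) (use Na small in auto)
    also have "\<dots> = c * (\<Sum>k\<in>{m..<n}. (1/2)^k)"
      by (simp add: sum_distrib_left)
    also have "\<dots> \<le> c * (2 * (1/2)^m)"
      using sum_tail[of m "n - m"] that c0 by (intro mult_left_mono) auto
    finally show ?thesis by simp
  qed
  have "\<exists>K. \<forall>m\<ge>K. \<forall>n\<ge>K. N (\<lambda>x. S m x - S n x) < e" if "0 < e" for e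
  proof -
    have "(\<lambda>m. 2 * c * (1/2::real) ^ m) \<longlonglongrightarrow> 2 * c * 0"
      by (intro tendsto_intros LIMSEQ_realpow_zero) auto
    then have "\<forall>\<^sub>F m in sequentially. 2 * c * (1/2::real) ^ m < e"
      using \<open>0 < e\<close> by (intro order_tendstoD(2)[where y = "2*c*0"]) auto
    then obtain K where K: "\<And>m. m \<ge> K \<Longrightarrow> 2 * c * (1/2::real) ^ m < e"
      by (auto simp: eventually_sequentially)
    have "N (\<lambda>x. S m x - S n x) < e" if "m \<ge> K" "n \<ge> K" for m n
    proof (cases "m \<le> n")
      case True
      then show ?thesis
        using tail[OF True] K[OF \<open>m \<ge> K\<close>] N_minus_commute[OF SX SX, of m n] by simp
    next
      case False
      then show ?thesis
        using tail[of n m] K[OF \<open>n \<ge> K\<close>] by simp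
    qed
    then show ?thesis by blast
  qed
  then obtain f where f: "f \<in> X" and lim: "(\<lambda>n. N (\<lambda>x. S n x - f x)) \<longlonglongrightarrow> 0"
    using complete SX unfolding norm_complete_def by blast
  have "AE x in \<mu>. cmod (u n x) \<le> cmod (f x)" for n
  proof -
    \<comment> \<open>the excess of the term over the limit\<close>
    define d where "d x = complex_of_real (max 0 (cmod (u n x) - cmod (f x)))" for x
    note [measurable] = X_L0[OF u[of n]] X_L0[OF f]
    have dX: "d \<in> X"
      unfolding d_def[abs_def] by (rule X_solid[OF u[of n]]) auto
    have le: "N d \<le> N (\<lambda>x. S m x - f x)" if "m > n" for m
    proof (rule N_mono[OF X_diff[OF SX f] dX], rule AE_I2)
      fix x
      have "cmod (u n x) \<le> (\<Sum>k<m. cmod (u k x))"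
        using that by (intro member_le_sum) auto
      also have "(\<Sum>k<m. cmod (u k x)) = cmod (S m x)"
        by (simp add: S_def a_def flip: of_real_sum) (simp add: sum_nonneg)
      finally have "cmod (u n x) - cmod (f x) \<le> cmod (S m x - f x)"
        using norm_triangle_ineq2[of "S m x" "f x"] by linarith
      then show "cmod (d x) \<le> cmod (S m x - f x)"
        by (simp add: d_def)
    qed
    have "N d \<le> 0"
      by (rule tendsto_lowerbound[OF lim _ sequentially_bot])
         (use le in \<open>auto simp: eventually_sequentially intro!: exI[of _ "Suc n"]\<close>)
    then have "N d = 0" using N_nonneg[OF dX] by simp
    then have "AE x in \<mu>. d x = 0" using N_eq_0[OF dX] by simp
    then show ?thesis
      by eventually_elim (auto simp: d_def max_def split: if_splits)
  qed
  then show ?thesis using that f by blast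
qed

end

section \<open>Rearrangement invariance and dilations\<close>

lemma dilation_eq: "dilation s f x = indicator {-1<..<1} (s * x) *\<^sub>R f (s * x)"
  by (auto simp: dilation_def indicator_def)

lemma L0_extend: "f \<in> L0 \<Longrightarrow> (\<lambda>x. indicator {-1<..<1} x *\<^sub>R f x) \<in> borel_measurable borel"
  unfolding \<mu>_def by (subst (asm) borel_measurable_restrict_space_iff) auto

lemma borel_L0: "f \<in> borel_measurable borel \<Longrightarrow> f \<in> L0"
  unfolding \<mu>_def by (rule measurable_restrict_space1) simp

lemma dilation_L0:
  assumes "f \<in> L0" shows "dilation s f \<in> L0"
proof -
  note [measurable] = L0_extend[OF assms]
  have "(\<lambda>x. (\<lambda>x. indicator {-1<..<1} x *\<^sub>R f x) (s * x)) \<in> borel_measurable borel"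
    by (rule measurable_compose[OF _ L0_extend[OF assms]]) measurable
  then show ?thesis
    by (intro borel_L0) (simp add: dilation_eq[abs_def])
qed

lemma sets_superlevel: "f \<in> L0 \<Longrightarrow> {x \<in> space \<mu>. l < cmod (f x)} \<in> sets \<mu>"
  by measurable

text \<open>
  Level sets of the dilated function are level sets of \<open>f\<close> scaled by \<open>t\<close>, so their measure
  shrinks by the factor \<open>t\<close>.
\<close>

lemma distribution_dilation_le:
  assumes f: "f \<in> L0" and t: "0 < t" "t < 1" and l: "0 \<le> l"
  shows "distribution_function (dilation (1 / t) f) l \<le> distribution_function f l"
proof -
  interpret finite_measure \<mu> by (rule finite_measure_\<mu>)
  define A where "A = {x \<in> space \<mu>. l < cmod (f x)}"
  define B where "B = {x \<in> space \<mu>. l < cmod (dilation (1 / t) f x)}"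
  have A: "A \<in> sets \<mu>" and B: "B \<in> sets \<mu>"
    unfolding A_def B_def by (intro sets_superlevel f dilation_L0)+
  then have [measurable]: "A \<in> sets borel" "B \<in> sets borel"
    by (auto simp: sets_\<mu>_iff)
  have sub: "indicator B x \<le> (indicator A (0 + 1/t * x) :: ennreal)" for x
    using l by (auto simp: A_def B_def dilation_eq indicator_def split: if_splits)
  have "emeasure lborel B = (\<integral>\<^sup>+x. indicator B x \<partial>lborel)"
    by simp
  also have "\<dots> \<le> (\<integral>\<^sup>+x. indicator A (0 + 1/t * x) \<partial>lborel)"
    by (rule nn_integral_mono) (rule sub)
  also have "\<dots> \<le> ennreal \<bar>1/t\<bar> * (\<integral>\<^sup>+x. indicator A (0 + 1/t * x) \<partial>lborel)"
  proof -
    have "1 \<le> ennreal \<bar>1/t\<bar>" using t by simp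
    then show ?thesis using mult_right_mono[of 1 "ennreal \<bar>1/t\<bar>"] by fastforce
  qed
  also have "\<dots> = (\<integral>\<^sup>+x. indicator A x \<partial>lborel)"
    by (rule nn_integral_real_affine[symmetric]) (use t in auto)
  also have "\<dots> = emeasure lborel A" by simp
  finally have "emeasure \<mu> B \<le> emeasure \<mu> A"
    by (simp add: emeasure_\<mu> A B)
  then show ?thesis
    unfolding distribution_function_def A_def[symmetric] B_def[symmetric]
    by (simp add: emeasure_eq_measure)
qed

lemma rearrangement_mono:
  assumes "\<And>l. 0 \<le> l \<Longrightarrow> distribution_function g l \<le> distribution_function f l"
  shows "decreasing_rearrangement g s \<le> decreasing_rearrangement f s"
  unfolding decreasing_rearrangement_def
  by (rule INF_superset_mono) (use assms order_trans in blast)+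

locale ri_space =
  fixes X :: "(real \<Rightarrow> complex) set" and N :: "(real \<Rightarrow> complex) \<Rightarrow> real"
  assumes ri: "rearrangement_invariant X N"

sublocale ri_space \<subseteq> bfs
  using ri by unfold_locales (simp add: rearrangement_invariant_def)

context ri_space
begin

lemma X_rearrangement:
  assumes "f \<in> X" "g \<in> L0"
    and "\<And>l. 0 \<le> l \<Longrightarrow> distribution_function g l \<le> distribution_function f l"
  shows "g \<in> X"
  using ri rearrangement_mono[OF assms(3)] assms(1,2)
  unfolding rearrangement_invariant_def by blast

lemma X_dilation: "f \<in> X \<Longrightarrow> 0 < t \<Longrightarrow> t < 1 \<Longrightarrow> dilation (1 / t) f \<in> X"
  by (rule X_rearrangement) (auto intro: dilation_L0 X_L0 distribution_dilation_le)

text \<open>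
  Dilations are positive, and they respect almost everywhere inequalities because scaling preserves null sets.
\<close>

lemma N_dilation_mono:
  assumes f: "f \<in> X" "g \<in> X" and t: "0 < t" "t < 1" and "0 \<le> C"
    and le: "AE x in \<mu>. cmod (f x) \<le> C * cmod (g x)"
  shows "N (dilation (1 / t) f) \<le> C * N (dilation (1 / t) g)"
proof -
  define F where "F = (\<lambda>x. indicator {-1<..<1} x *\<^sub>R f x)"
  define G where "G = (\<lambda>x. indicator {-1<..<1} x *\<^sub>R g x)"
  have [measurable]: "F \<in> borel_measurable borel" "G \<in> borel_measurable borel"
    unfolding F_def G_def by (intro L0_extend X_L0 f)+
  have "AE x in lborel. cmod (F x) \<le> C * cmod (G x)"
    using le unfolding AE_\<mu>_iff by eventually_elim (auto simp: F_def G_def indicator_def)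
  then have "AE x in lborel. cmod (F (0 + 1/t * x)) \<le> C * cmod (G (0 + 1/t * x))"
    by (intro AE_borel_affine) (use t in auto)
  then have ae: "AE x in \<mu>. cmod (dilation (1 / t) f x) \<le> C * cmod (dilation (1 / t) g x)"
    unfolding AE_\<mu>_iff by eventually_elim (simp add: dilation_eq F_def G_def)
  note Eg = X_dilation[OF f(2) t] and Ef = X_dilation[OF f(1) t]
  have "N (dilation (1 / t) f) \<le> N (\<lambda>x. complex_of_real C * dilation (1 / t) g x)"
    by (rule N_mono[OF X_scale[OF Eg] Ef])
       (use ae \<open>0 \<le> C\<close> in \<open>simp add: norm_mult\<close>)
  also have "\<dots> = C * N (dilation (1 / t) g)"
    using N_scale[OF Eg, of "complex_of_real C"] \<open>0 \<le> C\<close> by simp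
  finally show ?thesis .
qed

text \<open>
  Positive operators on a complete normed lattice are bounded: if the norms of the images of \<open>f n\<close>
  grew like \<open>4 ^ n\<close> on the unit ball, a function dominating all \<open>f n / 2 ^ n\<close> would have an
  image of norm above every \<open>2 ^ n\<close>. Without boundedness the supremum defining the operator norm,
  and hence the hypothesis on the Boyd index, would carry no information.
\<close>

lemma dilation_bounded:
  assumes t: "0 < t" "t < 1"
  shows "bdd_above ((\<lambda>f. N (dilation (1 / t) f)) ` {f \<in> X. N f \<le> 1})"
proof (rule ccontr)
  assume "\<not> ?thesis"
  then have "\<exists>f\<in>X. N f \<le> 1 \<and> 4 ^ n < N (dilation (1 / t) f)" for n :: nat
    unfolding bdd_above_def by (auto simp: not_le)
  then obtain f where f: "\<And>n. f n \<in> X" "\<And>n. N (f n) \<le> 1"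
    "\<And>n::nat. 4 ^ n < N (dilation (1 / t) (f n))"
    by metis
  define u where "u n x = complex_of_real ((1/2) ^ n) * f n x" for n x
  have uX: "u n \<in> X" for n
    unfolding u_def[abs_def] by (rule X_scale[OF f(1)])
  have "N (u n) \<le> 1 * (1/2) ^ n" for n
    unfolding u_def[abs_def] using N_scale[OF f(1), of "complex_of_real ((1/2) ^ n)" n] f(2)[of n]
    by (simp add: norm_power norm_divide mult_left_le)
  then obtain h where h: "h \<in> X" and dom: "\<And>n. AE x in \<mu>. cmod (u n x) \<le> cmod (h x)"
    using dominating_function[of u 1] uX by blast
  have bound: "2 ^ n < N (dilation (1 / t) h)" for n
  proof -
    have "AE x in \<mu>. cmod (f n x) \<le> 2 ^ n * cmod (h x)"
      using dom[of n]
      by eventually_elim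
         (simp add: u_def norm_mult norm_power norm_divide field_simps power_one_over)
    then have "N (dilation (1 / t) (f n)) \<le> 2 ^ n * N (dilation (1 / t) h)"
      by (intro N_dilation_mono[OF f(1) h t]) simp_all
    then have "4 ^ n < 2 ^ n * N (dilation (1 / t) h)"
      using f(3)[of n] by linarith
    moreover have "(4::real) ^ n = 2 ^ n * 2 ^ n"
      by (simp flip: power_mult_distrib)
    ultimately show ?thesis by simp
  qed
  obtain n where "N (dilation (1 / t) h) < 2 ^ n"
    using real_arch_pow[of 2] by auto
  then show False using bound[of n] by simp
qed

lemma N_dilation_le:
  assumes t: "0 < t" "t < 1" and f: "f \<in> X"
  shows "N (dilation (1 / t) f) \<le> op_norm X N (dilation (1 / t)) * N f"
proof (cases "N f = 0")
  case True
  then have "AE x in \<mu>. cmod (f x) \<le> 0 * cmod (f x)"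
    using N_eq_0[OF f] by simp
  from N_dilation_mono[OF f f t order.refl this] show ?thesis using True by simp
next
  case False
  then have pos: "0 < N f" using N_nonneg[OF f] by simp
  define g where "g x = complex_of_real (1 / N f) * f x" for x
  have g: "g \<in> X" unfolding g_def[abs_def] by (rule X_scale[OF f])
  have "N g = 1"
    unfolding g_def[abs_def] using N_scale[OF f, of "complex_of_real (1 / N f)"] pos
    by (simp add: norm_divide)
  then have "N (dilation (1 / t) g) \<le> op_norm X N (dilation (1 / t))"
    unfolding op_norm_def by (intro cSUP_upper dilation_bounded t) (use g in auto)
  moreover have "AE x in \<mu>. cmod (f x) \<le> N f * cmod (g x)"
    using pos by (simp add: g_def norm_mult norm_divide)
  from N_dilation_mono[OF f g t less_imp_le[OF pos] this]
  have "N (dilation (1 / t) f) \<le> N f * N (dilation (1 / t) g)" .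
  ultimately have "N (dilation (1 / t) f) \<le> N f * op_norm X N (dilation (1 / t))"
    using pos by (meson less_imp_le mult_left_mono order_trans)
  then show ?thesis by (simp add: mult.commute)
qed

text \<open>
  The index is a supremum of quotients with negative denominator \<open>ln t\<close>, so its positivity means that
  some dilation has norm below 1. Its iterates carry \<open>(-1, 1)\<close> to \<open>(-t ^ k, t ^ k)\<close>. Passing
  to a power of \<open>t\<close> gives the decay \<open>(1/4) ^ k\<close>, which leaves room for weights
  \<open>2 ^ k\<close>.
\<close>

lemma small_intervals:
  assumes "0 < lower_boyd_index X N"
  obtains r where "0 < r" "r \<le> 1/2"
    "\<And>k::nat. N (indicator {- (r^k)<..<r^k}) \<le> (1/4) ^ k * N (\<lambda>x. 1)"
proof -
  obtain t where t: "0 < t" "t < 1" and "0 < ln (op_norm X N (dilation (1 / t))) / ln t"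
    using assms unfolding lower_boyd_index_def less_SUP_iff by auto
  then have "ln (op_norm X N (dilation (1 / t))) < 0"
    using ln_less_zero[OF t] by (simp add: zero_less_divide_iff)
  then have q: "op_norm X N (dilation (1 / t)) < 1"
    using ln_ge_zero by (meson not_le)
  define q' where "q' = max 0 (op_norm X N (dilation (1 / t)))"
  have q': "0 \<le> q'" "q' < 1" using q by (auto simp: q'_def)
  have ind: "indicator {- (t^k)<..<t^k} \<in> X" for k
    by (rule X_indicator) (use power_le_one[of t k] t in \<open>auto simp: sets_\<mu>_iff\<close>)
  have Nk: "N (indicator {- (t^k)<..<t^k}) \<le> q' ^ k * N (\<lambda>x. 1)" for k :: nat
  proof (induction k)
    case 0
    have "N (indicator {- (t^0)<..<t^0}) \<le> 1 * N (\<lambda>x. 1)"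
      by (rule N_const_bound[OF ind]) (auto simp: indicator_def)
    then show ?case by simp
  next
    case (Suc k)
    have tk: "t ^ k \<le> 1" using power_le_one[of t k] t by simp
    have eq: "dilation (1 / t) (indicator {- (t^k)<..<t^k}) = indicator {- (t^Suc k)<..<t^Suc k}"
      (is "?l = ?r")
    proof
      fix x
      have "(- (t^k) < x / t \<and> x / t < t^k) \<longleftrightarrow> (- (t * t^k) < x \<and> x < t * t^k)"
        using t by (simp add: field_simps)
      then show "?l x = ?r x"
        using tk by (auto simp: dilation_def indicator_def)
    qed
    have "N (dilation (1 / t) (indicator {- (t^k)<..<t^k}))
        \<le> op_norm X N (dilation (1 / t)) * N (indicator {- (t^k)<..<t^k})"
      by (rule N_dilation_le[OF t ind])
    also have "\<dots> \<le> q' * N (indicator {- (t^k)<..<t^k})"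
      by (intro mult_right_mono N_nonneg ind) (simp add: q'_def)
    also have "\<dots> \<le> q' * (q' ^ k * N (\<lambda>x. 1))"
      by (intro mult_left_mono Suc q')
    finally show ?case unfolding eq by (simp add: mult.assoc)
  qed
  obtain p1 where p1: "q' ^ p1 < 1/4"
    using real_arch_pow_inv[of "1/4" q'] q' by auto
  obtain p2 where p2: "t ^ p2 < 1/2"
    using real_arch_pow_inv[of "1/2" t] t by auto
  define p where "p = p1 + p2"
  have "q' ^ p \<le> q' ^ p1" "t ^ p \<le> t ^ p2"
    unfolding p_def by (rule power_decreasing; use q' t in simp)+
  then have p: "q' ^ p \<le> 1/4" "t ^ p \<le> 1/2" using p1 p2 by auto
  show ?thesis
  proof (rule that[of "t ^ p"])
    show "0 < t ^ p" "t ^ p \<le> 1/2" using t p by auto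
    fix k :: nat
    have "N (indicator {- (t^(p*k))<..<t^(p*k)}) \<le> q' ^ (p*k) * N (\<lambda>x. 1)" by (rule Nk)
    also have "\<dots> \<le> (1/4) ^ k * N (\<lambda>x. 1)"
      unfolding power_mult by (intro mult_right_mono power_mono p) (use q' N_one_pos in auto)
    finally show "N (indicator {- ((t^p)^k)<..<(t^p)^k}) \<le> (1/4) ^ k * N (\<lambda>x. 1)"
      by (simp add: power_mult)
  qed
qed

end

section \<open>Sets of small measure have small norm\<close>

context ri_space
begin

text \<open>
  Otherwise there are sets \<open>A k\<close> of measure below \<open>r ^ k\<close> whose indicators have norm at
  least \<open>\<delta>\<close>. The sum of the \<open>2 ^ k * indicator (A k)\<close> exceeds level
  \<open>2 ^ k - 1\<close> only on the union of the later \<open>A n\<close>, a set of measure at most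
  \<open>2 * r ^ k\<close>, the length of \<open>(-r ^ k, r ^ k)\<close>. An element of \<open>X\<close> exceeding
  \<open>2 ^ (k + 1) - 1\<close> on each of these intervals exists by domination, so the sum lies in \<open>X\<close>
  by rearrangement; but its norm is at least \<open>2 ^ k * \<delta>\<close> for every \<open>k\<close>.
\<close>

lemma norm_indicator_small:
  assumes boyd: "0 < lower_boyd_index X N" and "0 < \<delta>"
  obtains \<eta> where "0 < \<eta>"
    "\<And>A. A \<in> sets \<mu> \<Longrightarrow> measure \<mu> A < \<eta> \<Longrightarrow> N (indicator A) < \<delta>"
proof (rule ccontr)
  interpret finite_measure \<mu> by (rule finite_measure_\<mu>)
  obtain r where r: "0 < r" "r \<le> 1/2"
    and Nr: "\<And>k::nat. N (indicator {- (r^k)<..<r^k}) \<le> (1/4) ^ k * N (\<lambda>x. 1)"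
    using small_intervals[OF boyd] by blast
  define I where "I k = {- (r^k)<..<r^k}" for k :: nat
  have rk: "0 < r ^ k" "r ^ k \<le> 1" for k using r power_le_one[of r k] by auto
  have I: "I k \<in> sets \<mu>" for k using rk(2)[of k] by (auto simp: sets_\<mu>_iff I_def)
  assume "\<not> thesis"
  then have "\<exists>A \<in> sets \<mu>. measure \<mu> A < r ^ k \<and> \<delta> \<le> N (indicator A)" for k :: nat
    using that[of "r ^ k"] rk(1)[of k] by force
  then obtain A where A: "\<And>k::nat. A k \<in> sets \<mu>" "\<And>k. measure \<mu> (A k) < r ^ k"
    "\<And>k. \<delta> \<le> N (indicator (A k))"
    by metis
  have r1: "norm r < 1" using r by simp
  have summ: "summable (\<lambda>k. measure \<mu> (A k))"
    by (rule summable_comparison_test'[OF summable_geometric[OF r1]])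
       (use A(2) in \<open>auto intro: less_imp_le\<close>)
  have tail: "measure \<mu> (\<Union>n. A (n + k)) \<le> 2 * r ^ k" for k
  proof -
    have s: "summable (\<lambda>n. measure \<mu> (A (n + k)))"
      using summ by (subst summable_iff_shift)
    have "measure \<mu> (\<Union>n. A (n + k)) \<le> (\<Sum>n. measure \<mu> (A (n + k)))"
      by (rule finite_measure_subadditive_countably) (use A(1) s in auto)
    also have "\<dots> \<le> (\<Sum>n. r ^ k * r ^ n)"
      using summable_geometric[OF r1] A(2)
      by (intro suminf_le s summable_mult)
         (auto intro!: less_imp_le simp: mult.commute simp flip: power_add)
    also have "\<dots> = r ^ k * (1 / (1 - r))"
      using suminf_mult[OF summable_geometric[OF r1], of "r^k"] suminf_geometric[OF r1] by simp
    also have "\<dots> \<le> r ^ k * 2"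
      using r by (intro mult_left_mono) (auto simp: field_simps)
    finally show ?thesis by simp
  qed
  have limsup: "AE x in \<mu>. finite {k. x \<in> A k}"
  proof -
    have "AE x in \<mu>. \<forall>\<^sub>F n in sequentially. x \<in> space \<mu> - A n"
      by (rule borel_cantelli_AE1) (use A(1) summ in \<open>auto simp: emeasure_eq_measure\<close>)
    then show ?thesis
    proof eventually_elim
      case (elim x)
      then obtain m where "\<And>n. m \<le> n \<Longrightarrow> x \<notin> A n" by (auto simp: eventually_sequentially)
      then have "{k. x \<in> A k} \<subseteq> {..<m}" by (auto simp: not_le[symmetric])
      then show ?case using finite_subset by blast
    qed
  qed
  \<comment> \<open>A function in \<open>X\<close> of size \<open>2 ^ k\<close> on each interval \<open>I k\<close>. It is doubled below since a
    level between \<open>2 ^ k - 1\<close> and \<open>2 ^ (k + 1) - 1\<close> has to be exceeded on \<open>I k\<close>.\<close>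
  define u where "u k x = complex_of_real (2 ^ k) * indicator (I k) x" for k :: nat and x
  have IX: "(indicator (I k) :: real \<Rightarrow> complex) \<in> X" for k by (rule X_indicator[OF I])
  have uX: "u k \<in> X" for k unfolding u_def[abs_def] by (rule X_scale[OF IX])
  have Nu: "N (u k) \<le> N (\<lambda>x. 1) * (1/2) ^ k" for k
  proof -
    have "N (u k) = 2 ^ k * N (indicator (I k))"
      unfolding u_def[abs_def] using N_scale[OF IX, of "complex_of_real (2 ^ k)" k]
      by (simp add: norm_power)
    also have "\<dots> \<le> 2 ^ k * ((1/4) ^ k * N (\<lambda>x. 1))"
      using Nr[of k] by (intro mult_left_mono) (auto simp: I_def)
    also have "\<dots> = (2 * (1/4)) ^ k * N (\<lambda>x. 1)"
      by (simp only: power_mult_distrib mult.assoc)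
    finally show ?thesis by (simp add: mult.commute)
  qed
  obtain h where h: "h \<in> X" and dom: "\<And>k. AE x in \<mu>. cmod (u k x) \<le> cmod (h x)"
    using dominating_function[OF uX Nu] by blast
  define f where "f x = 2 * h x" for x
  have f: "f \<in> X" unfolding f_def[abs_def] by (rule X_scale[OF h])
  have f_large: "AE x in \<mu>. x \<in> I k \<longrightarrow> 2 ^ (k + 1) \<le> cmod (f x)" for k
    using dom[of k] by eventually_elim (auto simp: u_def f_def norm_mult norm_power)
  \<comment> \<open>Almost every point lies in finitely many \<open>A k\<close> only; where the series diverges, its value is
    arbitrary.\<close>
  define g where "g x = complex_of_real (\<Sum>k. 2 ^ k * indicator (A k) x)" for x
  have [measurable]: "A k \<in> sets \<mu>" for k by (rule A)
  have g: "g \<in> L0" unfolding g_def by measurable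
  have g_fin: "(\<Sum>k. 2 ^ k * indicator (A k) x :: real) = (\<Sum>k | x \<in> A k. 2 ^ k)"
    if "finite {k. x \<in> A k}" for x
    by (subst suminf_finite[OF that]) (auto simp: indicator_def)
  have g_small: "x \<in> (\<Union>n. A (n + k))"
    if fin: "finite {k. x \<in> A k}" and gx: "2 ^ k - 1 < cmod (g x)" for x k
  proof (rule ccontr)
    assume "x \<notin> (\<Union>n. A (n + k))"
    then have sub: "{k. x \<in> A k} \<subseteq> {..<k}"
      by (auto simp: not_le[symmetric]) (metis le_add_diff_inverse2)
    have "cmod (g x) = (\<Sum>k | x \<in> A k. 2 ^ k)"
      by (simp add: g_def g_fin[OF fin] del: of_real_sum) (simp add: sum_nonneg)
    also have "\<dots> \<le> (\<Sum>k<k. 2 ^ k)"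
      by (intro sum_mono2 sub) auto
    also have "\<dots> = 2 ^ k - 1" by (induction k) auto
    finally show False using gx by simp
  qed
  have gX: "g \<in> X"
  proof (rule X_rearrangement[OF f g])
    fix l :: real assume l: "0 \<le> l"
    have "\<exists>k::nat. 2 ^ k - 1 \<le> l \<and> l < 2 ^ (k + 1) - 1"
    proof -
      obtain m where m: "l + 1 < 2 ^ m" using real_arch_pow[of 2 "l+1"] by auto
      define j where "j = (LEAST m. l + 1 < (2::real) ^ m)"
      have j: "l + 1 < 2 ^ j" unfolding j_def by (rule LeastI[where P = "\<lambda>m. l + 1 < (2::real) ^ m", OF m])
      have "j \<noteq> 0" using j l by (cases j) auto
      then obtain k where k: "j = Suc k" by (cases j) auto
      have "\<not> l + 1 < 2 ^ k" using not_less_Least[of k "\<lambda>m. l + 1 < (2::real) ^ m"] k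
        unfolding j_def by simp
      then show ?thesis using j k by (intro exI[of _ k]) auto
    qed
    then obtain k :: nat where k: "2 ^ k - 1 \<le> l" "l < 2 ^ (k + 1) - 1" by blast
    have "distribution_function g l \<le> measure \<mu> (\<Union>n. A (n + k))"
      unfolding distribution_function_def
    proof (rule finite_measure_mono_AE)
      show "AE x in \<mu>. x \<in> {x \<in> space \<mu>. l < cmod (g x)} \<longrightarrow> x \<in> (\<Union>n. A (n + k))"
        using limsup by eventually_elim (use g_small k in force)
    qed auto
    also have "\<dots> \<le> 2 * r ^ k" by (rule tail)
    also have "\<dots> = measure \<mu> (I k)"
      using rk(1)[of k] by (simp add: measure_\<mu>[OF I]) (simp add: I_def)
    also have "\<dots> \<le> distribution_function f l"
      unfolding distribution_function_def
    proof (rule finite_measure_mono_AE)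
      show "AE x in \<mu>. x \<in> I k \<longrightarrow> x \<in> {x \<in> space \<mu>. l < cmod (f x)}"
        using f_large[of k] AE_space
        by eventually_elim (use k in auto)
    qed (rule sets_superlevel, rule X_L0[OF f])
    finally show "distribution_function g l \<le> distribution_function f l" .
  qed
  have "2 ^ k * \<delta> \<le> N g" for k
  proof -
    have AX: "(indicator (A k) :: real \<Rightarrow> complex) \<in> X" by (rule X_indicator[OF A(1)])
    have "N (\<lambda>x. complex_of_real (2 ^ k) * indicator (A k) x) \<le> N g"
    proof (rule N_mono[OF gX X_scale[OF AX]])
      show "AE x in \<mu>. cmod (complex_of_real (2 ^ k) * indicator (A k) x) \<le> cmod (g x)"
        using limsup
      proof eventually_elim
        case (elim x)
        have *: "cmod (g x) = (\<Sum>k | x \<in> A k. 2 ^ k)"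
          by (simp add: g_def g_fin[OF elim] del: of_real_sum) (simp add: sum_nonneg)
        show ?case
        proof (cases "x \<in> A k")
          case True
          then have "2 ^ k \<le> (\<Sum>k | x \<in> A k. 2 ^ k :: real)"
            using elim by (intro member_le_sum[where f = "\<lambda>k. 2 ^ k :: real"]) auto
          then show ?thesis using True by (simp add: * norm_power)
        qed simp
      qed
    qed
    then have "2 ^ k * N (indicator (A k)) \<le> N g"
      using N_scale[OF AX, of "complex_of_real (2 ^ k)"] by (simp add: norm_power)
    moreover have "2 ^ k * \<delta> \<le> 2 ^ k * N (indicator (A k))"
      using A(3)[of k] by (intro mult_left_mono) auto
    ultimately show ?thesis by linarith
  qed
  then have "2 ^ k \<le> N g / \<delta>" for k using \<open>0 < \<delta>\<close> by (simp add: field_simps)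
  moreover obtain k where "N g / \<delta> < 2 ^ k" using real_arch_pow[of 2 "N g / \<delta>"] by auto
  ultimately show False using not_less by blast
qed

text \<open>
  For functions bounded by 1, convergence to 0 in measure implies convergence to 0 in norm: the function is
  dominated by a small constant plus the indicator of a small set.
\<close>

lemma norm_small_of_measure:
  assumes boyd: "0 < lower_boyd_index X N" and "0 < \<delta>"
  obtains \<eta> where "0 < \<eta>"
    "\<And>f. f \<in> L0 \<Longrightarrow> (\<And>x. -1 < x \<Longrightarrow> x < 1 \<Longrightarrow> cmod (f x) \<le> 1) \<Longrightarrow>
       measure \<mu> {x \<in> space \<mu>. \<eta> < cmod (f x)} < \<eta> \<Longrightarrow> N f < \<delta>"
proof -
  obtain \<eta> where \<eta>: "0 < \<eta>"
    "\<And>A. A \<in> sets \<mu> \<Longrightarrow> measure \<mu> A < \<eta> \<Longrightarrow> N (indicator A) < \<delta> / 2"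
    using norm_indicator_small[OF boyd, of "\<delta> / 2"] \<open>0 < \<delta>\<close> by auto
  define \<epsilon> where "\<epsilon> = min \<eta> (\<delta> / 2 / N (\<lambda>x. 1))"
  have \<epsilon>: "0 < \<epsilon>" "\<epsilon> \<le> \<eta>" "\<epsilon> * N (\<lambda>x. 1) \<le> \<delta> / 2"
    using \<eta>(1) \<open>0 < \<delta>\<close> N_one_pos by (auto simp: \<epsilon>_def min_def field_simps)
  show ?thesis
  proof (rule that[of \<epsilon>])
    fix f assume f: "f \<in> L0" and le: "\<And>x. -1 < x \<Longrightarrow> x < 1 \<Longrightarrow> cmod (f x) \<le> 1"
      and small: "measure \<mu> {x \<in> space \<mu>. \<epsilon> < cmod (f x)} < \<epsilon>"
    define A where "A = {x \<in> space \<mu>. \<epsilon> < cmod (f x)}"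
    have A: "A \<in> sets \<mu>" unfolding A_def by (rule sets_superlevel[OF f])
    have "N f \<le> N (\<lambda>x. complex_of_real \<epsilon> * 1 + indicator A x)"
    proof (rule N_mono)
      show "AE x in \<mu>. cmod (f x) \<le> cmod (complex_of_real \<epsilon> * 1 + indicator A x)"
      proof (rule AE_\<mu>_I)
        fix x :: real assume x: "-1 < x" "x < 1"
        have "cmod (complex_of_real \<epsilon> + 1) = \<epsilon> + 1"
          using \<epsilon> by (metis norm_of_real abs_of_pos add_pos_pos of_real_1 of_real_add zero_less_one)
        then show "cmod (f x) \<le> cmod (complex_of_real \<epsilon> * 1 + indicator A x)"
          using x le[OF x] \<epsilon> by (auto simp: indicator_def A_def)
      qed
    qed (use f le A in \<open>auto intro!: X_add X_const X_indicator intro: X_bounded\<close>)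
    also have "\<dots> \<le> N (\<lambda>x. complex_of_real \<epsilon> * 1) + N (indicator A)"
      by (intro N_triangle X_scale X_const X_indicator A)
    also have "\<dots> = \<epsilon> * N (\<lambda>x. 1) + N (indicator A)"
      using N_scale[OF X_const[of 1], of "complex_of_real \<epsilon>"] \<epsilon> by simp
    also have "\<dots> < \<delta> / 2 + \<delta> / 2"
      using \<epsilon> \<eta>(2)[OF A] small by (intro add_le_less_mono) (auto simp: A_def)
    finally show "N f < \<delta>" by simp
  qed (use \<epsilon> in auto)
qed

end

section \<open>Averages of Chebyshev sines and cosines\<close>

lemma has_integral_cos_int:
  fixes j :: int
  shows "((\<lambda>\<theta>. cos (of_int j * \<theta>)) has_integral (if j = 0 then pi else 0)) {0..pi}"
proof (cases "j = 0")
  case True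
  then show ?thesis using has_integral_const_real[of "1::real" 0 pi] by simp
next
  case False
  have "((\<lambda>\<theta>. cos (of_int j * \<theta>)) has_integral
      (sin (of_int j * pi) / of_int j - sin (of_int j * 0) / of_int j)) {0..pi}"
    using False
    by (intro fundamental_theorem_of_calculus)
       (auto intro!: derivative_eq_intros simp flip: has_real_derivative_iff_has_vector_derivative)
  then show ?thesis using False sin_npi_int[of j] by (simp add: mult.commute)
qed

lemma has_integral_trig_orthogonal:
  fixes p q :: nat
  assumes "e = sin \<or> e = cos" "0 < p" "0 < q"
  shows "((\<lambda>\<theta>. e (p * \<theta>) * e (q * \<theta>)) has_integral (if p = q then pi / 2 else 0)) {0..pi}"
proof -
  define \<sigma> :: real where "\<sigma> = (if e = cos then 1 else -1)"
  have eq: "e (p * \<theta>) * e (q * \<theta>)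
      = (cos (of_int (int p - int q) * \<theta>) + \<sigma> * cos (of_int (int p + int q) * \<theta>)) / 2" for \<theta> :: real
    using assms(1) cos_zero sin_zero
    by (auto simp: \<sigma>_def sin_times_sin cos_times_cos field_simps fun_eq_iff)
  show ?thesis
    unfolding eq
    by (rule has_integral_eq_rhs, rule has_integral_divide, rule has_integral_add,
        rule has_integral_cos_int, rule has_integral_mult_right, rule has_integral_cos_int)
       (use assms in auto)
qed

lemma has_integral_trig_sum_square:
  fixes a :: "nat \<Rightarrow> real"
  assumes e: "e = sin \<or> e = cos" and K: "finite K" "0 \<notin> K"
  shows "((\<lambda>\<theta>. (\<Sum>k\<in>K. a k * e (k * \<theta>))\<^sup>2) has_integral (pi / 2 * (\<Sum>k\<in>K. (a k)\<^sup>2))) {0..pi}"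
proof -
  have eq: "(\<Sum>k\<in>K. a k * e (k * \<theta>))\<^sup>2
      = (\<Sum>k\<in>K. \<Sum>l\<in>K. (a k * a l) * (e (k * \<theta>) * e (l * \<theta>)))" for \<theta> :: real
    unfolding power2_eq_square sum_product by (simp add: algebra_simps)
  have pos: "0 < k" if "k \<in> K" for k using that K by (metis neq0_conv)
  have "((\<lambda>\<theta>. \<Sum>k\<in>K. \<Sum>l\<in>K. (a k * a l) * (e (k * \<theta>) * e (l * \<theta>))) has_integral
      (\<Sum>k\<in>K. \<Sum>l\<in>K. (a k * a l) * (if k = l then pi / 2 else 0))) {0..pi}"
    by (intro has_integral_sum K has_integral_mult_right has_integral_trig_orthogonal e pos)
  moreover have "(\<Sum>k\<in>K. \<Sum>l\<in>K. (a k * a l) * (if k = l then pi / 2 else 0))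
      = pi / 2 * (\<Sum>k\<in>K. (a k)\<^sup>2)"
    using K by (simp add: if_distrib sum.delta power2_eq_square sum_distrib_left mult.commute
      cong: if_cong)
  ultimately show ?thesis unfolding eq by simp
qed

text \<open>
  The substitution \<open>x = cos \<theta>\<close>, which turns Chebyshev functions into plain sines and cosines.
\<close>

lemma integral_arccos:
  fixes P :: "real \<Rightarrow> real"
  assumes "continuous_on {0..pi} P"
  shows "((\<lambda>\<theta>. sin \<theta> * P \<theta>) has_integral integral {-1..1} (\<lambda>x. P (arccos x))) {0..pi}"
proof -
  have "((\<lambda>\<theta>. - sin \<theta> *\<^sub>R P (arccos (cos \<theta>))) has_integral
      (integral {cos 0..cos pi} (\<lambda>x. P (arccos x)) - integral {cos pi..cos 0} (\<lambda>x. P (arccos x)))) {0..pi}"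
    by (rule has_integral_substitution_general[of "{}" _ _ _ "-1" 1])
       (auto intro!: continuous_intros derivative_eq_intros continuous_on_compose2[OF assms]
         simp: arccos_lbound arccos_ubound)
  from has_integral_neg[OF this] show ?thesis
    by (rule has_integral_eq[rotated, THEN has_integral_eq_rhs]) (auto simp: arccos_cos)
qed

lemma integral_\<mu>_continuous:
  fixes g :: "real \<Rightarrow> real"
  assumes "continuous_on {-1..1} g"
  shows "integrable \<mu> g" "integral\<^sup>L \<mu> g = integral {-1..1} g"
proof -
  have "set_integrable lborel {-1..1} g"
    by (rule borel_integrable_atLeastAtMost'[OF assms])
  then have s: "set_integrable lborel {-1<..<1} g"
    by (rule set_integrable_subset) auto
  show "integrable \<mu> g"
    using s unfolding \<mu>_def set_integrable_def by (subst integrable_restrict_space) auto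
  have "integral\<^sup>L \<mu> g = (LBINT x:{-1<..<1}. g x)"
    unfolding \<mu>_def set_lebesgue_integral_def by (subst integral_restrict_space) auto
  also have "\<dots> = integral {-1<..<1} g"
    by (rule set_borel_integral_eq_integral[OF s])
  finally show "integral\<^sup>L \<mu> g = integral {-1..1} g"
    by (simp add: integral_open_interval_real)
qed

text \<open>
  For \<open>e = cos\<close> this is the Chebyshev polynomial \<open>T\<^sub>n\<close>; for \<open>e = sin\<close> it is
  \<open>sqrt (1 - x\<^sup>2) * U\<^bsub>n-1\<^esub> x\<close>, with the Chebyshev polynomial of the second kind. Both
  families are handled at once wherever only orthogonality and boundedness matter.
\<close>

definition trig_fun :: "(real \<Rightarrow> real) \<Rightarrow> nat \<Rightarrow> real \<Rightarrow> complex" where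
  "trig_fun e n x = complex_of_real (e (n * arccos x))"

lemma continuous_trig_arccos:
  "e = sin \<or> e = cos \<Longrightarrow> continuous_on {-1..1} (\<lambda>x. e (real n * arccos x))"
  by (elim disjE; simp; intro continuous_intros; auto)

lemma trig_fun_bound: "e = sin \<or> e = cos \<Longrightarrow> cmod (trig_fun e n x) \<le> 1"
  by (auto simp: trig_fun_def)

lemma trig_fun_L0: "e = sin \<or> e = cos \<Longrightarrow> trig_fun e n \<in> L0"
  unfolding trig_fun_def[abs_def]
  by (intro continuous_on_L0 continuous_on_of_real continuous_trig_arccos)

lemma (in bfs) trig_fun_X: "e = sin \<or> e = cos \<Longrightarrow> trig_fun e n \<in> X"
  by (rule X_bounded[OF trig_fun_L0 trig_fun_bound])

lemma (in bfs) functional_sum: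
  assumes \<phi>: "bounded_linear_functional X N \<phi>" and u: "\<And>k. k \<in> K \<Longrightarrow> u k \<in> X"
  shows "\<phi> (\<lambda>x. \<Sum>k\<in>K. c k * u k x) = (\<Sum>k\<in>K. c k * \<phi> (u k))"
proof -
  have add: "\<And>f g. f \<in> X \<Longrightarrow> g \<in> X \<Longrightarrow> \<phi> (\<lambda>x. f x + g x) = \<phi> f + \<phi> g"
    and scale: "\<And>c f. f \<in> X \<Longrightarrow> \<phi> (\<lambda>x. c * f x) = c * \<phi> f"
    using \<phi> by (auto simp: bounded_linear_functional_def)
  have zero: "\<phi> (\<lambda>x. 0) = 0" using scale[OF X_zero, of 0] by simp
  show ?thesis using u
  proof (induction K rule: infinite_finite_induct)
    case (insert k K)
    then show ?case
      using add[OF X_scale[of "u k" "c k"] X_sum[of K "\<lambda>k x. c k * u k x"]] scale[of "u k" "c k"]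
      by (simp add: X_scale)
  qed (simp_all add: zero)
qed

context ri_space
begin

text \<open>
  Orthogonality gives the average over \<open>K\<close> a squared \<open>L\<^sup>2\<close> norm of at most
  \<open>pi / (2 * card K)\<close>: the weight \<open>sin \<theta>\<close> produced by the substitution is at most 1 and
  may be dropped. Markov's inequality then makes the set where the average exceeds \<open>\<eta>\<close> small.
  The bound depends on \<open>K\<close> only through its size, so the indices can be picked from any infinite set.
\<close>

lemma trig_average_small:
  assumes boyd: "0 < lower_boyd_index X N" and "0 < \<delta>" and e: "e = sin \<or> e = cos"
  obtains M :: nat where "0 < M"
    "\<And>K c. finite K \<Longrightarrow> 0 \<notin> K \<Longrightarrow> M \<le> card K \<Longrightarrow> (\<And>k. k \<in> K \<Longrightarrow> cmod (c k) \<le> 1) \<Longrightarrow>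
       N (\<lambda>x. complex_of_real (1 / card K) * (\<Sum>k\<in>K. c k * trig_fun e k x)) < \<delta>"
proof -
  interpret finite_measure \<mu> by (rule finite_measure_\<mu>)
  obtain \<eta> where \<eta>: "0 < \<eta>"
    and small: "\<And>f. f \<in> L0 \<Longrightarrow> (\<And>x. -1 < x \<Longrightarrow> x < 1 \<Longrightarrow> cmod (f x) \<le> 1) \<Longrightarrow>
       measure \<mu> {x \<in> space \<mu>. \<eta> < cmod (f x)} < \<eta> \<Longrightarrow> N f < \<delta>"
    using norm_small_of_measure[OF boyd \<open>0 < \<delta>\<close>] by blast
  obtain M0 :: nat where M0: "pi / 2 / \<eta> ^ 3 < M0" using reals_Archimedean2 by blast
  show ?thesis
  proof (rule that[of "Suc M0"])
    fix K :: "nat set" and c :: "nat \<Rightarrow> complex"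
    assume K: "finite K" "0 \<notin> K" "Suc M0 \<le> card K" and c: "\<And>k. k \<in> K \<Longrightarrow> cmod (c k) \<le> 1"
    define m where "m = real (card K)"
    have m: "0 < m" "M0 < m" using K by (auto simp: m_def)
    define F where "F x = complex_of_real (1 / m) * (\<Sum>k\<in>K. c k * trig_fun e k x)" for x
    have [measurable]: "trig_fun e k \<in> L0" for k by (rule trig_fun_L0[OF e])
    have F: "F \<in> L0" unfolding F_def[abs_def] by measurable
    have F1: "cmod (F x) \<le> 1" for x
    proof -
      have "cmod (\<Sum>k\<in>K. c k * trig_fun e k x) \<le> (\<Sum>k\<in>K. 1)"
        by (rule sum_norm_le)
           (use c trig_fun_bound[OF e] in \<open>auto simp: norm_mult intro: mult_le_one\<close>)
      then show ?thesis using m by (simp add: F_def norm_mult norm_divide m_def field_simps)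
    qed
    define P where "P \<theta> = (1 / m)\<^sup>2 * ((\<Sum>k\<in>K. Re (c k) * e (k * \<theta>))\<^sup>2 + (\<Sum>k\<in>K. Im (c k) * e (k * \<theta>))\<^sup>2)"
      for \<theta> :: real
    have P0: "0 \<le> P \<theta>" for \<theta> by (simp add: P_def)
    have e_cont: "continuous_on UNIV e" using e by (auto intro: continuous_intros)
    have P_cont: "continuous_on S P" for S
      unfolding P_def by (intro continuous_intros continuous_on_compose2[OF e_cont]) auto
    have FP: "(cmod (F x))\<^sup>2 = P (arccos x)" for x
      by (simp add: F_def P_def norm_mult power_mult_distrib cmod_power2 Re_sum Im_sum trig_fun_def
          norm_divide power_divide m_def)
    have P_cont': "continuous_on {-1..1} (\<lambda>x. P (arccos x))"
      by (rule continuous_on_compose2[OF P_cont[of UNIV]]) (auto intro!: continuous_intros)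
    have "((\<lambda>\<theta>. P \<theta>) has_integral
        (1 / m)\<^sup>2 * (pi / 2 * (\<Sum>k\<in>K. (Re (c k))\<^sup>2) + pi / 2 * (\<Sum>k\<in>K. (Im (c k))\<^sup>2))) {0..pi}"
      unfolding P_def
      by (intro has_integral_mult_right has_integral_add has_integral_trig_sum_square e K)
    also have "(1 / m)\<^sup>2 * (pi / 2 * (\<Sum>k\<in>K. (Re (c k))\<^sup>2) + pi / 2 * (\<Sum>k\<in>K. (Im (c k))\<^sup>2))
        = (1 / m)\<^sup>2 * (pi / 2 * (\<Sum>k\<in>K. (cmod (c k))\<^sup>2))"
      by (simp add: cmod_power2 sum.distrib algebra_simps)
    finally have intP: "(P has_integral (1 / m)\<^sup>2 * (pi / 2 * (\<Sum>k\<in>K. (cmod (c k))\<^sup>2))) {0..pi}" .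
    have "integral\<^sup>L \<mu> (\<lambda>x. P (arccos x)) = integral {-1..1} (\<lambda>x. P (arccos x))"
      by (rule integral_\<mu>_continuous[OF P_cont'])
    also have "\<dots> \<le> (1 / m)\<^sup>2 * (pi / 2 * (\<Sum>k\<in>K. (cmod (c k))\<^sup>2))"
      by (rule has_integral_le[OF integral_arccos[OF P_cont] intP])
         (use P0 in \<open>auto intro: mult_left_le_one_le sin_ge_zero\<close>)
    also have "\<dots> \<le> (1 / m)\<^sup>2 * (pi / 2 * (\<Sum>k\<in>K. 1))"
      by (intro mult_left_mono sum_mono) (use c in \<open>auto simp: abs_square_le_1 power_le_one\<close>)
    also have "\<dots> = pi / 2 / m"
      using m by (simp add: m_def power2_eq_square field_simps)
    finally have int_le: "integral\<^sup>L \<mu> (\<lambda>x. P (arccos x)) \<le> pi / 2 / m" .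
    have "measure \<mu> {x \<in> space \<mu>. \<eta> < cmod (F x)} \<le> measure \<mu> {x \<in> space \<mu>. \<eta>\<^sup>2 \<le> P (arccos x)}"
    proof (rule finite_measure_mono)
      show "{x \<in> space \<mu>. \<eta> < cmod (F x)} \<subseteq> {x \<in> space \<mu>. \<eta>\<^sup>2 \<le> P (arccos x)}"
        using \<eta> by (auto simp flip: FP intro!: power_mono)
      have [measurable]: "(\<lambda>x. P (arccos x)) \<in> borel_measurable \<mu>"
        using integral_\<mu>_continuous(1)[OF P_cont'] by auto
      show "{x \<in> space \<mu>. \<eta>\<^sup>2 \<le> P (arccos x)} \<in> sets \<mu>" by measurable
    qed
    also have "\<dots> \<le> integral\<^sup>L \<mu> (\<lambda>x. P (arccos x)) / \<eta>\<^sup>2"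
      using integral_Markov_inequality_measure[OF integral_\<mu>_continuous(1)[OF P_cont'],
          of "{}" "\<eta>\<^sup>2"] P0 \<eta> by simp
    also have "\<dots> \<le> pi / 2 / m / \<eta>\<^sup>2"
      using int_le by (intro divide_right_mono) auto
    also have "\<dots> < \<eta>"
    proof -
      have "pi / 2 / \<eta> ^ 3 < m" using M0 m by linarith
      then show ?thesis
        using \<eta> m by (simp add: field_simps power3_eq_cube power2_eq_square)
    qed
    finally have "measure \<mu> {x \<in> space \<mu>. \<eta> < cmod (F x)} < \<eta>" .
    from small[OF F F1 this]
    show "N (\<lambda>x. complex_of_real (1 / card K) * (\<Sum>k\<in>K. c k * trig_fun e k x)) < \<delta>"
      by (simp add: F_def[abs_def] m_def)
  qed simp
qed

text \<open>
  The Banach-Saks type argument: aligning the phases of the values of \<open>\<phi>\<close> by unimodular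
  coefficients keeps the functional large on averages whose norm tends to 0.
\<close>

lemma trig_fun_weakly_null:
  assumes boyd: "0 < lower_boyd_index X N" and "0 < \<delta>" and e: "e = sin \<or> e = cos"
    and \<phi>: "bounded_linear_functional X N \<phi>"
  shows "finite {n. 0 < n \<and> \<delta> \<le> cmod (\<phi> (trig_fun e n))}" (is "finite ?S")
proof (rule ccontr)
  assume inf: "infinite ?S"
  obtain C where C: "\<And>f. f \<in> X \<Longrightarrow> cmod (\<phi> f) \<le> C * N f"
    using \<phi> unfolding bounded_linear_functional_def by blast
  define C' where "C' = \<bar>C\<bar> + 1"
  have C': "0 < C'" "\<And>f. f \<in> X \<Longrightarrow> cmod (\<phi> f) \<le> C' * N f"
  proof -
    fix f assume "f \<in> X"
    then have "C * N f \<le> C' * N f"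
      unfolding C'_def by (intro mult_right_mono N_nonneg) auto
    then show "cmod (\<phi> f) \<le> C' * N f" using C[OF \<open>f \<in> X\<close>] by linarith
  qed (simp add: C'_def)
  have "0 < \<delta> / C'" using \<open>0 < \<delta>\<close> C' by simp
  obtain M :: nat where M: "0 < M"
    "\<And>K c. finite K \<Longrightarrow> 0 \<notin> K \<Longrightarrow> M \<le> card K \<Longrightarrow> (\<And>k. k \<in> K \<Longrightarrow> cmod (c k) \<le> 1) \<Longrightarrow>
       N (\<lambda>x. complex_of_real (1 / card K) * (\<Sum>k\<in>K. c k * trig_fun e k x)) < \<delta> / C'"
    using trig_average_small[OF boyd \<open>0 < \<delta> / C'\<close> e] by blast
  obtain K where K: "finite K" "card K = M" "K \<subseteq> ?S"
    using infinite_arbitrarily_large[OF inf] by blast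
  define c where "c k = cnj (sgn (\<phi> (trig_fun e k)))" for k
  have c1: "cmod (c k) \<le> 1" for k by (simp add: c_def norm_sgn)
  have c2: "c k * \<phi> (trig_fun e k) = complex_of_real (cmod (\<phi> (trig_fun e k)))" for k
    using complex_norm_square[of "\<phi> (trig_fun e k)"]
    by (cases "\<phi> (trig_fun e k) = 0")
       (simp_all add: c_def sgn_div_norm scaleR_conv_of_real field_simps power2_eq_square)
  define S where "S x = (\<Sum>k\<in>K. c k * trig_fun e k x)" for x
  have SX: "S \<in> X"
    unfolding S_def[abs_def] by (intro X_sum X_scale trig_fun_X e)
  have "\<phi> (\<lambda>x. complex_of_real (1 / M) * S x) = complex_of_real (1 / M) * \<phi> S"
    using \<phi> SX unfolding bounded_linear_functional_def by blast
  also have "\<phi> S = complex_of_real (\<Sum>k\<in>K. cmod (\<phi> (trig_fun e k)))"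
    unfolding S_def[abs_def] by (subst functional_sum[OF \<phi> trig_fun_X[OF e]]) (simp add: c2)
  finally have "cmod (\<phi> (\<lambda>x. complex_of_real (1 / M) * S x))
      = 1 / M * (\<Sum>k\<in>K. cmod (\<phi> (trig_fun e k)))"
    by (simp add: norm_mult norm_divide sum_nonneg del: of_real_sum)
  moreover have "(\<Sum>k\<in>K. \<delta>) \<le> (\<Sum>k\<in>K. cmod (\<phi> (trig_fun e k)))"
    by (intro sum_mono) (use K in auto)
  then have "1 / M * (\<Sum>k\<in>K. \<delta>) \<le> 1 / M * (\<Sum>k\<in>K. cmod (\<phi> (trig_fun e k)))"
    by (rule mult_left_mono) simp
  moreover have "1 / M * (\<Sum>k\<in>K. \<delta>) = \<delta>"
    using K M(1) by simp
  ultimately have "\<delta> \<le> cmod (\<phi> (\<lambda>x. complex_of_real (1 / M) * S x))"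
    by linarith
  also have "\<dots> \<le> C' * N (\<lambda>x. complex_of_real (1 / M) * S x)"
    by (intro C' X_scale SX)
  also have "\<dots> < C' * (\<delta> / C')"
    using M(2)[of K c] K c1 C'(1) unfolding S_def[abs_def]
    by (intro mult_strict_left_mono) auto
  finally show False using C'(1) by simp
qed

end

section \<open>Principal values and the finite Hilbert transform\<close>

text \<open>
  The factor \<open>1 / pi\<close> is left out. Gauge integrals over closed intervals allow the fundamental theorem
  of calculus to be applied directly; for continuous \<open>f\<close> they agree with the Lebesgue integrals.
\<close>

definition has_principal_value :: "(real \<Rightarrow> real) \<Rightarrow> real \<Rightarrow> real \<Rightarrow> bool" where
  "has_principal_value f t L \<longleftrightarrow>
     ((\<lambda>\<epsilon>. integral {-1..t - \<epsilon>} (\<lambda>x. f x / (x - t)) + integral {t + \<epsilon>..1} (\<lambda>x. f x / (x - t)))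
       \<longlongrightarrow> L) (at_right 0)"

lemma set_integral_of_real_open_interval:
  fixes g :: "real \<Rightarrow> real"
  assumes "continuous_on {a..b} g"
  shows "(LBINT x:{a<..<b}. complex_of_real (g x)) = complex_of_real (integral {a..b} g)"
proof -
  have "set_integrable lborel {a..b} g"
    by (rule borel_integrable_atLeastAtMost'[OF assms])
  then have s: "set_integrable lborel {a<..<b} g"
    by (rule set_integrable_subset) auto
  have "(LBINT x:{a<..<b}. complex_of_real (g x)) = complex_of_real (LBINT x:{a<..<b}. g x)"
    by (rule set_integral_complex_of_real)
  also have "(LBINT x:{a<..<b}. g x) = integral {a<..<b} g"
    by (rule set_borel_integral_eq_integral[OF s])
  finally show ?thesis by (simp add: integral_open_interval_real)
qed

lemma continuous_on_Cauchy_kernel: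
  fixes f :: "real \<Rightarrow> real"
  assumes "continuous_on {-1..1} f" "S \<subseteq> {-1..1}" "t \<notin> S"
  shows "continuous_on S (\<lambda>x. f x / (x - t))"
  by (intro continuous_intros continuous_on_subset[OF assms(1)] assms) (use assms in auto)

lemma eventually_truncation:
  fixes t :: real
  assumes "-1 < t" "t < 1"
  shows "\<forall>\<^sub>F \<epsilon> in at_right 0. 0 < \<epsilon> \<and> -1 < t - \<epsilon> \<and> t + \<epsilon> < 1"
  unfolding eventually_at_right_field
  by (rule exI[of _ "min (t + 1) (1 - t)"]) (use assms in auto)

lemma finite_hilbert_transform_eq:
  assumes f: "continuous_on {-1..1} f" and t: "-1 < t" "t < 1"
    and pv: "has_principal_value f t L"
  shows "finite_hilbert_transform (\<lambda>x. complex_of_real (f x)) t = complex_of_real (L / pi)"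
proof -
  let ?I = "\<lambda>\<epsilon>. integral {-1..t - \<epsilon>} (\<lambda>x. f x / (x - t)) + integral {t + \<epsilon>..1} (\<lambda>x. f x / (x - t))"
  let ?J = "\<lambda>\<epsilon>. complex_of_real (1 / pi) *
       ((LBINT x:{-1<..<t - \<epsilon>}. complex_of_real (f x) / complex_of_real (x - t)) +
        (LBINT x:{t + \<epsilon><..<1}. complex_of_real (f x) / complex_of_real (x - t)))"
  have "((\<lambda>\<epsilon>. complex_of_real (1 / pi * ?I \<epsilon>)) \<longlongrightarrow> complex_of_real (1 / pi * L)) (at_right 0)"
    using pv unfolding has_principal_value_def by (intro tendsto_intros)
  moreover have "\<forall>\<^sub>F \<epsilon> in at_right 0. complex_of_real (1 / pi * ?I \<epsilon>) = ?J \<epsilon>"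
    using eventually_truncation[OF t]
  proof eventually_elim
    case (elim \<epsilon>)
    have "(LBINT x:{-1<..<t - \<epsilon>}. complex_of_real (f x / (x - t)))
        = complex_of_real (integral {-1..t - \<epsilon>} (\<lambda>x. f x / (x - t)))"
      by (intro set_integral_of_real_open_interval continuous_on_Cauchy_kernel f) (use elim t in auto)
    moreover have "(LBINT x:{t + \<epsilon><..<1}. complex_of_real (f x / (x - t)))
        = complex_of_real (integral {t + \<epsilon>..1} (\<lambda>x. f x / (x - t)))"
      by (intro set_integral_of_real_open_interval continuous_on_Cauchy_kernel f) (use elim t in auto)
    ultimately show ?case by simp
  qed
  ultimately have "(?J \<longlongrightarrow> complex_of_real (1 / pi * L)) (at_right 0)"
    by (rule Lim_transform_eventually)
  then have "Lim (at_right 0) ?J = complex_of_real (1 / pi * L)"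
    by (intro tendsto_Lim) auto
  then show ?thesis unfolding finite_hilbert_transform_def by simp
qed

lemma has_principal_value_diff:
  assumes "continuous_on {-1..1} f" "continuous_on {-1..1} g" and t: "-1 < t" "t < 1"
    and pv: "has_principal_value f t L" "has_principal_value g t M"
  shows "has_principal_value (\<lambda>x. c * f x - g x) t (c * L - M)"
proof -
  let ?I = "\<lambda>f \<epsilon>. integral {-1..t - \<epsilon>} (\<lambda>x. f x / (x - t)) + integral {t + \<epsilon>..1} (\<lambda>x. f x / (x - t))"
  have "((\<lambda>\<epsilon>. c * ?I f \<epsilon> - ?I g \<epsilon>) \<longlongrightarrow> c * L - M) (at_right 0)"
    using pv unfolding has_principal_value_def by (intro tendsto_intros)
  moreover have "\<forall>\<^sub>F \<epsilon> in at_right 0. c * ?I f \<epsilon> - ?I g \<epsilon> = ?I (\<lambda>x. c * f x - g x) \<epsilon>"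
    using eventually_truncation[OF t]
  proof eventually_elim
    case (elim \<epsilon>)
    have int: "(\<lambda>x. h x / (x - t)) integrable_on S"
      if "continuous_on {-1..1} h" "S = {-1..t - \<epsilon>} \<or> S = {t + \<epsilon>..1}" for h S
      using that elim t
      by (auto intro!: integrable_continuous_real continuous_on_Cauchy_kernel[OF that(1)])
    have eq: "integral S (\<lambda>x. (c * f x - g x) / (x - t))
        = c * integral S (\<lambda>x. f x / (x - t)) - integral S (\<lambda>x. g x / (x - t))"
      if S: "S = {-1..t - \<epsilon>} \<or> S = {t + \<epsilon>..1}" for S
    proof -
      have "(\<lambda>x. (c * f x - g x) / (x - t)) = (\<lambda>x. c * (f x / (x - t)) - g x / (x - t))"
        by (simp add: diff_divide_distrib)
      then have "integral S (\<lambda>x. (c * f x - g x) / (x - t))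
          = integral S (\<lambda>x. c * (f x / (x - t)) - g x / (x - t))"
        by (rule arg_cong)
      also have "\<dots> = integral S (\<lambda>x. c * (f x / (x - t))) - integral S (\<lambda>x. g x / (x - t))"
        by (rule integral_diff[OF integrable_on_mult_right[OF int[OF assms(1) S]] int[OF assms(2) S]])
      finally have "integral S (\<lambda>x. (c * f x - g x) / (x - t))
          = integral S (\<lambda>x. c * (f x / (x - t))) - integral S (\<lambda>x. g x / (x - t))" .
      moreover have "integral S (\<lambda>x. c * (f x / (x - t))) = c * integral S (\<lambda>x. f x / (x - t))"
        by (rule Henstock_Kurzweil_Integration.integral_mult_right)
      ultimately show ?thesis by argo
    qed
    have alg: "c * (p + q) - (u + v) = (c * p - u) + (c * q - v)" for p q u v
      by (simp add: algebra_simps)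
    show ?case unfolding eq[OF disjI1[OF refl]] eq[OF disjI2[OF refl]] by (rule alg)
  qed
  ultimately show ?thesis
    unfolding has_principal_value_def by (rule Lim_transform_eventually)
qed

text \<open>
  From \<open>x / (x - t) = t / (x - t) + 1\<close>. This is what makes the transform compatible with the
  three-term recurrences of Chebyshev polynomials.
\<close>

lemma has_principal_value_times:
  assumes f: "continuous_on {-1..1} f" and t: "-1 < t" "t < 1" and pv: "has_principal_value f t L"
  shows "has_principal_value (\<lambda>x. x * f x) t (t * L + integral {-1..1} f)"
proof -
  let ?I = "\<lambda>f \<epsilon>. integral {-1..t - \<epsilon>} (\<lambda>x. f x / (x - t)) + integral {t + \<epsilon>..1} (\<lambda>x. f x / (x - t))"
  define G where "G y = integral {-1..y} f" for y
  have int: "f integrable_on {-1..1}" by (rule integrable_continuous_real[OF f])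
  have Gcont: "continuous_on {-1..1} G"
    unfolding G_def[abs_def] by (rule indefinite_integral_continuous_1[OF int])
  then have G: "isCont G t"
    by (rule continuous_on_interior) (use t in auto)
  have "((\<lambda>\<epsilon>. G (t - \<epsilon>)) \<longlongrightarrow> G t) (at_right 0)" "((\<lambda>\<epsilon>. G (t + \<epsilon>)) \<longlongrightarrow> G t) (at_right 0)"
    by (rule isCont_tendsto_compose[OF G], rule tendsto_eq_intros, rule tendsto_const,
        rule tendsto_ident_at, simp)+
  then have "((\<lambda>\<epsilon>. t * ?I f \<epsilon> + (G (t - \<epsilon>) + (G 1 - G (t + \<epsilon>)))) \<longlongrightarrow> t * L + (G t + (G 1 - G t)))
      (at_right 0)"
    using pv unfolding has_principal_value_def by (intro tendsto_intros)
  moreover have "t * L + (G t + (G 1 - G t)) = t * L + integral {-1..1} f"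
    by (simp add: G_def)
  ultimately have "((\<lambda>\<epsilon>. t * ?I f \<epsilon> + (G (t - \<epsilon>) + (G 1 - G (t + \<epsilon>)))) \<longlongrightarrow> t * L + integral {-1..1} f)
      (at_right 0)"
    by (simp only:)
  moreover have "\<forall>\<^sub>F \<epsilon> in at_right 0.
      t * ?I f \<epsilon> + (G (t - \<epsilon>) + (G 1 - G (t + \<epsilon>))) = ?I (\<lambda>x. x * f x) \<epsilon>"
    using eventually_truncation[OF t]
  proof eventually_elim
    case (elim \<epsilon>)
    have eq: "integral S (\<lambda>x. (x * f x) / (x - t)) = t * integral S (\<lambda>x. f x / (x - t)) + integral S f"
      if S: "S = {-1..t - \<epsilon>} \<or> S = {t + \<epsilon>..1}" for S
    proof -
      have tS: "t \<notin> S" and SI: "S \<subseteq> {-1..1}" using S elim t by auto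
      have int1: "(\<lambda>x. f x / (x - t)) integrable_on S"
        using S continuous_on_Cauchy_kernel[OF f SI tS] by (auto intro: integrable_continuous_real)
      have int2: "f integrable_on S"
        using S continuous_on_subset[OF f SI] by (auto intro: integrable_continuous_real)
      have "integral S (\<lambda>x. (x * f x) / (x - t)) = integral S (\<lambda>x. t * (f x / (x - t)) + f x)"
      proof (rule integral_cong)
        fix x assume "x \<in> S"
        then have "x - t \<noteq> 0" using tS by auto
        then show "x * f x / (x - t) = t * (f x / (x - t)) + f x" by (simp add: field_simps)
      qed
      also have "\<dots> = integral S (\<lambda>x. t * (f x / (x - t))) + integral S f"
        by (rule integral_add[OF integrable_on_mult_right[OF int1] int2])
      finally have "integral S (\<lambda>x. (x * f x) / (x - t))
          = integral S (\<lambda>x. t * (f x / (x - t))) + integral S f" .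
      moreover have "integral S (\<lambda>x. t * (f x / (x - t))) = t * integral S (\<lambda>x. f x / (x - t))"
        by (rule Henstock_Kurzweil_Integration.integral_mult_right)
      ultimately show ?thesis by argo
    qed
    have "integral {-1..t + \<epsilon>} f + integral {t + \<epsilon>..1} f = integral {-1..1} f"
      by (rule Henstock_Kurzweil_Integration.integral_combine) (use elim t int in auto)
    then have "G (t - \<epsilon>) + (G 1 - G (t + \<epsilon>)) = integral {-1..t - \<epsilon>} f + integral {t + \<epsilon>..1} f"
      unfolding G_def by linarith
    moreover have alg: "t * (p + q) + (u + v) = (t * p + u) + (t * q + v)" for p q u v
      by (simp add: algebra_simps)
    ultimately show ?case
      unfolding eq[OF disjI1[OF refl]] eq[OF disjI2[OF refl]] by (simp only: alg)
  qed
  ultimately show ?thesis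
    unfolding has_principal_value_def by (rule Lim_transform_eventually)
qed

text \<open>
  An explicit antiderivative of \<open>w x / (x - t)\<close>, where \<open>w x = sqrt (1 - x\<^sup>2)\<close> and
  \<open>s = w t\<close>, is \<open>w x - t * arcsin x + s * ln (\<bar>x - t\<bar> / (1 - t * x + s * w x))\<close>. The
  logarithm vanishes at both end points, and its singularity at \<open>t\<close> is symmetric, so it
  cancels between the two sides of \<open>t\<close>. What remains is the increment of \<open>- t * arcsin x\<close>.
\<close>

lemma has_principal_value_semicircle:
  assumes t: "-1 < t" "t < 1"
  shows "has_principal_value (\<lambda>x. sqrt (1 - x\<^sup>2)) t (- pi * t)"
proof -
  define s where "s = sqrt (1 - t\<^sup>2)"
  define w where "w x = sqrt (1 - x\<^sup>2)" for x :: real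
  define D where "D x = 1 - t * x + s * w x" for x
  define H where "H x = w x - t * arcsin x - s * ln (D x)" for x
  define G where "G x = H x + s * (ln ((x - t)\<^sup>2) / 2)" for x
  have t2: "t\<^sup>2 < 1" using t by (simp add: abs_square_less_1 abs_less_iff)
  have s: "0 < s" "s\<^sup>2 = 1 - t\<^sup>2" using t2 by (auto simp: s_def)
  have w0: "0 \<le> w x" if "-1 \<le> x" "x \<le> 1" for x
    using that by (simp add: w_def abs_square_le_1 abs_le_iff)
  have tx: "0 < 1 - t * x" if "-1 \<le> x" "x \<le> 1" for x
  proof -
    have "\<bar>t * x\<bar> \<le> \<bar>t\<bar> * 1" unfolding abs_mult using that by (intro mult_left_mono) auto
    then show ?thesis using t by linarith
  qed
  have Dpos: "0 < D x" if "-1 \<le> x" "x \<le> 1" for x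
    unfolding D_def using tx[OF that] w0[OF that] s by (intro add_pos_nonneg) auto
  have wcont: "continuous_on {-1..1} w" unfolding w_def by (intro continuous_intros)
  have Dcont: "continuous_on {-1..1} D" unfolding D_def by (intro continuous_intros wcont)
  have Hcont: "continuous_on {-1..1} H"
    unfolding H_def by (intro continuous_intros wcont Dcont) (use Dpos in force)+
  have Gcont: "continuous_on S G" if "S \<subseteq> {-1..1}" "t \<notin> S" for S
    unfolding G_def using that
    by (intro continuous_intros continuous_on_subset[OF Hcont]) auto
  have Gderiv: "(G has_real_derivative w x / (x - t)) (at x)" if x: "-1 < x" "x < 1" "x \<noteq> t" for x
  proof -
    have x2: "x\<^sup>2 < 1" using x by (simp add: abs_square_less_1 abs_less_iff)
    then have w: "0 < w x" "(w x)\<^sup>2 = 1 - x\<^sup>2" by (auto simp: w_def)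
    have D: "0 < D x" using Dpos x by simp
    have dw: "(w has_real_derivative (- x / w x)) (at x)"
      unfolding w_def using x2
      by (auto intro!: derivative_eq_intros simp: field_simps)
    have dD: "(D has_real_derivative (- t - s * x / w x)) (at x)"
      unfolding D_def by (auto intro!: derivative_eq_intros dw)
    have darc: "(arcsin has_real_derivative (1 / w x)) (at x)"
      using DERIV_arcsin[OF x(1,2)] by (simp add: w_def inverse_eq_divide)
    have dlog: "((\<lambda>x. ln ((x - t)\<^sup>2) / 2) has_real_derivative (1 / (x - t))) (at x)"
    proof -
      have pos: "0 < (x - t)\<^sup>2" using x by simp
      have "((\<lambda>x. ln ((x - t)\<^sup>2) / 2) has_real_derivative (2 * (x - t) / (x - t)\<^sup>2 / 2)) (at x)"
        using pos by (auto intro!: derivative_eq_intros simp: divide_simps)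
      moreover have "2 * d / d\<^sup>2 / 2 = 1 / d" for d :: real
        by (simp add: power2_eq_square)
      ultimately show ?thesis by (simp only:)
    qed
    have dlnD: "((\<lambda>x. ln (D x)) has_real_derivative ((- t - s * x / w x) / D x)) (at x)"
      using DERIV_chain2[OF DERIV_ln_divide[OF D] dD] by simp
    have dG: "(G has_real_derivative
        (- x / w x - t * (1 / w x) - s * ((- t - s * x / w x) / D x) + s * (1 / (x - t)))) (at x)"
      unfolding G_def[abs_def] H_def
      by (rule DERIV_add[OF DERIV_diff[OF DERIV_diff[OF dw DERIV_cmult[OF darc]] DERIV_cmult[OF dlnD]]
            DERIV_cmult[OF dlog]])
    \<comment> \<open>The two logarithms together have derivative \<open>s / (w x * (x - t))\<close>; this is the identity behind it.\<close>
    have key: "D x - (x - t) * (- t - s * x / w x) = s * D x / w x"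
    proof -
      have "w x * (D x - (x - t) * (- t - s * x / w x))
          = w x * (1 - t\<^sup>2) + s * ((w x)\<^sup>2 + x\<^sup>2 - t * x)"
        using w(1) by (simp add: D_def field_simps power2_eq_square)
      also have "\<dots> = w x * s\<^sup>2 + s * (1 - t * x)" by (simp add: w(2) s(2))
      also have "\<dots> = s * D x" by (simp add: D_def algebra_simps power2_eq_square)
      finally have "(D x - (x - t) * (- t - s * x / w x)) * w x = s * D x"
        by (subst mult.commute)
      then show ?thesis using w(1) by (intro eq_divide_imp) auto
    qed
    have "1 / (x - t) - (- t - s * x / w x) / D x
        = (D x - (x - t) * (- t - s * x / w x)) / ((x - t) * D x)"
      using D x by (simp add: divide_simps)
    also have "\<dots> = s / (w x * (x - t))"
      unfolding key using D x w(1) by (simp add: divide_simps)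
    finally have log: "1 / (x - t) - (- t - s * x / w x) / D x = s / (w x * (x - t))" .
    have "- x / w x - t * (1 / w x) - s * ((- t - s * x / w x) / D x) + s * (1 / (x - t))
        = - (x + t) / w x + s * (1 / (x - t) - (- t - s * x / w x) / D x)"
      by (simp add: algebra_simps add_divide_distrib diff_divide_distrib)
    also have "\<dots> = - (x + t) / w x + s\<^sup>2 / (w x * (x - t))"
      unfolding log by (simp add: power2_eq_square)
    also have "\<dots> = (- (x + t) * (x - t) + (1 - t\<^sup>2)) / (w x * (x - t))"
      unfolding s(2) using w(1) x by (simp add: divide_simps)
    also have "\<dots> = (w x)\<^sup>2 / (w x * (x - t))"
      unfolding w(2) by (simp add: algebra_simps power2_eq_square)
    also have "\<dots> = w x / (x - t)"
      using w(1) by (simp add: power2_eq_square)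
    finally show ?thesis using dG by simp
  qed
  have FTC: "integral {a..b} (\<lambda>x. w x / (x - t)) = G b - G a"
    if "a \<le> b" "{a..b} \<subseteq> {-1..1}" "t \<notin> {a..b}" for a b
  proof (rule integral_unique, rule fundamental_theorem_of_calculus_interior)
    show "continuous_on {a..b} G" by (rule Gcont) (use that in auto)
    fix x assume x: "x \<in> {a<..<b}"
    then have "-1 < x" "x < 1" using that(1,2) by auto
    then show "(G has_vector_derivative w x / (x - t)) (at x)"
      using Gderiv[of x] x that(3)
      by (auto simp flip: has_real_derivative_iff_has_vector_derivative)
  qed (use that in auto)
  have G1: "G 1 = - t * (pi / 2)" "G (-1) = t * (pi / 2)"
  proof -
    have "ln ((1 - t)\<^sup>2) = 2 * ln (1 - t)" "ln ((-1 - t)\<^sup>2) = 2 * ln (1 + t)"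
      using t ln_realpow[of "1 - t" 2] ln_realpow[of "1 + t" 2]
      by (auto simp: power2_eq_square algebra_simps)
    then show "G 1 = - t * (pi / 2)" "G (-1) = t * (pi / 2)"
      by (auto simp: G_def H_def D_def w_def arcsin_1 arcsin_minus_1)
  qed
  have H: "isCont H t" by (rule continuous_on_interior[OF Hcont]) (use t in auto)
  have "((\<lambda>\<epsilon>. H (t - \<epsilon>)) \<longlongrightarrow> H t) (at_right 0)" "((\<lambda>\<epsilon>. H (t + \<epsilon>)) \<longlongrightarrow> H t) (at_right 0)"
    by (rule isCont_tendsto_compose[OF H], rule tendsto_eq_intros, rule tendsto_const,
        rule tendsto_ident_at, simp)+
  then have "((\<lambda>\<epsilon>. H (t - \<epsilon>) - H (t + \<epsilon>) - pi * t) \<longlongrightarrow> H t - H t - pi * t) (at_right 0)"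
    by (intro tendsto_intros)
  then have "((\<lambda>\<epsilon>. H (t - \<epsilon>) - H (t + \<epsilon>) - pi * t) \<longlongrightarrow> - pi * t) (at_right 0)"
    by simp
  moreover have "\<forall>\<^sub>F \<epsilon> in at_right 0. H (t - \<epsilon>) - H (t + \<epsilon>) - pi * t
      = integral {-1..t - \<epsilon>} (\<lambda>x. w x / (x - t)) + integral {t + \<epsilon>..1} (\<lambda>x. w x / (x - t))"
    using eventually_truncation[OF t]
  proof eventually_elim
    case (elim \<epsilon>)
    have "integral {-1..t - \<epsilon>} (\<lambda>x. w x / (x - t)) = G (t - \<epsilon>) - G (-1)"
      "integral {t + \<epsilon>..1} (\<lambda>x. w x / (x - t)) = G 1 - G (t + \<epsilon>)"
      by (intro FTC; use elim t in auto)+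
    then show ?case unfolding G1 by (simp add: G_def field_simps)
  qed
  ultimately show ?thesis
    unfolding has_principal_value_def w_def by (rule Lim_transform_eventually)
qed

lemma integral_sin_arccos:
  assumes "0 < n"
  shows "integral {-1..1} (\<lambda>x. sin (real n * arccos x)) = (if n = 1 then pi / 2 else 0)"
proof -
  have "((\<lambda>\<theta>. sin \<theta> * sin (real n * \<theta>)) has_integral
      integral {-1..1} (\<lambda>x. sin (real n * arccos x))) {0..pi}"
    by (rule integral_arccos) (intro continuous_intros)
  moreover have "((\<lambda>\<theta>. sin \<theta> * sin (real n * \<theta>)) has_integral (if n = 1 then pi / 2 else 0)) {0..pi}"
    using has_integral_trig_orthogonal[of sin 1 n] assms by (auto split: if_splits)
  ultimately show ?thesis by (rule has_integral_unique)
qed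

text \<open>
  Induction along \<open>f (n + 2) = 2 * x * f (n + 1) - f n\<close>, a recurrence that the claimed values share.
  Multiplication by \<open>x\<close> adds the integral of \<open>f (n + 1)\<close>, which is nonzero only for
  \<open>f 1\<close>; there it accounts for \<open>f 0 = 0\<close> having transform 0 instead of the value \<open>-1\<close>
  that the general formula would give.
\<close>

lemma has_principal_value_sin_arccos:
  assumes t: "-1 < t" "t < 1"
  shows "has_principal_value (\<lambda>x. sin (real (Suc n) * arccos x)) t (- pi * cos (real (Suc n) * arccos t))"
proof -
  let ?f = "\<lambda>n x. sin (real n * arccos x)"
  have cont: "continuous_on {-1..1} (?f n)" for n by (rule continuous_trig_arccos) simp
  have rec: "?f (Suc (Suc n)) x = 2 * (x * ?f (Suc n) x) - ?f n x" if "-1 \<le> x" "x \<le> 1" for n x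
  proof -
    have "?f (Suc (Suc n)) x + ?f n x = 2 * (cos (arccos x) * ?f (Suc n) x)"
    proof -
      have "sin (a + b) + sin (a - b) = 2 * (cos b * sin a)" for a b :: real
        by (simp add: sin_add sin_diff)
      from this[of "real (Suc n) * arccos x" "arccos x"] show ?thesis
        by (simp add: algebra_simps)
    qed
    then show ?thesis using that by (simp add: cos_arccos)
  qed
  have rec_cos: "cos (real (Suc (Suc n)) * arccos t)
      = 2 * (t * cos (real (Suc n) * arccos t)) - cos (real n * arccos t)" for n
  proof -
    have "cos (a + b) + cos (a - b) = 2 * (cos b * cos a)" for a b :: real
      by (simp add: cos_add cos_diff)
    from this[of "real (Suc n) * arccos t" "arccos t"] show ?thesis
      using t by (simp add: algebra_simps cos_arccos)
  qed
  have cong: "has_principal_value g t L" if "has_principal_value f t L"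
    "\<And>x. -1 \<le> x \<Longrightarrow> x \<le> 1 \<Longrightarrow> g x = f x" for f g L
  proof -
    have "integral {-1..t - \<epsilon>} (\<lambda>x. f x / (x - t)) + integral {t + \<epsilon>..1} (\<lambda>x. f x / (x - t))
        = integral {-1..t - \<epsilon>} (\<lambda>x. g x / (x - t)) + integral {t + \<epsilon>..1} (\<lambda>x. g x / (x - t))"
      if "0 < \<epsilon> \<and> -1 < t - \<epsilon> \<and> t + \<epsilon> < 1" for \<epsilon>
      using that t \<open>\<And>x. -1 \<le> x \<Longrightarrow> x \<le> 1 \<Longrightarrow> g x = f x\<close>
      by (intro arg_cong2[where f = "(+)"] integral_cong) auto
    then have "\<forall>\<^sub>F \<epsilon> in at_right 0.
        integral {-1..t - \<epsilon>} (\<lambda>x. f x / (x - t)) + integral {t + \<epsilon>..1} (\<lambda>x. f x / (x - t))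
        = integral {-1..t - \<epsilon>} (\<lambda>x. g x / (x - t)) + integral {t + \<epsilon>..1} (\<lambda>x. g x / (x - t))"
      using eventually_truncation[OF t] by (auto elim!: eventually_mono)
    then show ?thesis
      using Lim_transform_eventually[OF that(1)[unfolded has_principal_value_def]]
      unfolding has_principal_value_def by (simp only:)
  qed
  have base1: "has_principal_value (?f (Suc 0)) t (- pi * cos (real (Suc 0) * arccos t))"
  proof -
    have "has_principal_value (?f (Suc 0)) t (- pi * t)"
      by (rule cong[OF has_principal_value_semicircle[OF t]]) (simp add: sin_arccos_abs sin_arccos)
    then show ?thesis using t by (simp add: cos_arccos)
  qed
  have step: "has_principal_value (?f (Suc (Suc n))) t
      (2 * (t * L + integral {-1..1} (?f (Suc n))) - M)"
    if "has_principal_value (?f (Suc n)) t L" "has_principal_value (?f n) t M" for n L M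
  proof (rule cong)
    have "continuous_on {-1..1} (\<lambda>x. x * ?f (Suc n) x)"
      by (rule continuous_on_mult[OF continuous_on_id cont])
    then show "has_principal_value (\<lambda>x. 2 * (x * ?f (Suc n) x) - ?f n x) t
        (2 * (t * L + integral {-1..1} (?f (Suc n))) - M)"
      by (rule has_principal_value_diff[OF _ cont t has_principal_value_times[OF cont t that(1)] that(2)])
  qed (rule rec)
  have "has_principal_value (?f (Suc n)) t (- pi * cos (real (Suc n) * arccos t)) \<and>
      has_principal_value (?f (Suc (Suc n))) t (- pi * cos (real (Suc (Suc n)) * arccos t))"
  proof (induction n)
    case 0
    have "has_principal_value (?f 0) t 0" by (simp add: has_principal_value_def)
    from step[OF base1 this] have "has_principal_value (?f (Suc (Suc 0))) t (- pi * cos (real (Suc (Suc 0)) * arccos t))"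
      unfolding rec_cos[of 0] using t integral_sin_arccos[of 1]
      by (simp add: cos_arccos algebra_simps)
    then show ?case using base1 by simp
  next
    case (Suc n)
    from step[OF conjunct2[OF Suc] conjunct1[OF Suc]]
    have "has_principal_value (?f (Suc (Suc (Suc n)))) t
        (- pi * cos (real (Suc (Suc (Suc n))) * arccos t))"
      unfolding rec_cos[of "Suc n"] integral_sin_arccos[OF zero_less_Suc]
      by (simp add: algebra_simps)
    then show ?case using Suc by simp
  qed
  then show ?thesis by simp
qed

lemma finite_hilbert_transform_sin_arccos:
  assumes "-1 < t" "t < 1" "0 < n"
  shows "finite_hilbert_transform (trig_fun sin n) t = - trig_fun cos n t"
proof -
  obtain m where n: "n = Suc m" using assms by (cases n) auto
  have "finite_hilbert_transform (\<lambda>x. complex_of_real (sin (real n * arccos x))) t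
      = complex_of_real (- pi * cos (real n * arccos t) / pi)"
    unfolding n by (intro finite_hilbert_transform_eq has_principal_value_sin_arccos continuous_trig_arccos assms) simp
  then show ?thesis by (simp add: trig_fun_def[abs_def])
qed

text \<open>
  For \<open>t\<close> to the right of the interval the integrand has no singularity, and the truncated integrals
  are eventually constant.
\<close>

lemma finite_hilbert_transform_indicator:
  assumes "-1 < b" "b < t" "t < 1"
  shows "finite_hilbert_transform (indicator {-1<..<b}) t = complex_of_real ((ln (t - b) - ln (t + 1)) / pi)"
proof -
  let ?J = "\<lambda>\<epsilon>. complex_of_real (1 / pi) *
       ((LBINT x:{-1<..<t - \<epsilon>}. indicator {-1<..<b} x / complex_of_real (x - t)) +
        (LBINT x:{t + \<epsilon><..<1}. indicator {-1<..<b} x / complex_of_real (x - t)))"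
  let ?L = "complex_of_real ((ln (t - b) - ln (t + 1)) / pi)"
  have "((\<lambda>x. 1 / (x - t)) has_integral (ln (t - b) - ln (t - (-1)))) {-1..b}"
    by (rule fundamental_theorem_of_calculus)
       (use assms in \<open>auto intro!: derivative_eq_intros simp: field_simps
         simp flip: has_real_derivative_iff_has_vector_derivative\<close>)
  then have int: "integral {-1..b} (\<lambda>x. 1 / (x - t)) = ln (t - b) - ln (t + 1)"
    by (simp add: integral_unique)
  have "\<forall>\<^sub>F \<epsilon> in at_right 0. ?L = ?J \<epsilon>"
    unfolding eventually_at_right_field
  proof (intro exI[of _ "t - b"] conjI allI impI)
    fix \<epsilon> :: real assume \<epsilon>: "0 < \<epsilon>" "\<epsilon> < t - b"
    have "(LBINT x:{t + \<epsilon><..<1}. indicator {-1<..<b} x / complex_of_real (x - t)) = (LBINT x:{t + \<epsilon><..<1}. 0)"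
      by (rule set_lebesgue_integral_cong) (use \<epsilon> assms in \<open>auto simp: indicator_def\<close>)
    moreover have "(LBINT x:{-1<..<t - \<epsilon>}. indicator {-1<..<b} x / complex_of_real (x - t))
        = (LBINT x:{-1<..<b}. complex_of_real (1 / (x - t)))"
      unfolding set_lebesgue_integral_def
      by (rule Bochner_Integration.integral_cong) (use \<epsilon> assms in \<open>auto simp: indicator_def\<close>)
    moreover have "\<dots> = complex_of_real (integral {-1..b} (\<lambda>x. 1 / (x - t)))"
      by (rule set_integral_of_real_open_interval) (use assms in \<open>auto intro!: continuous_intros\<close>)
    ultimately show "?L = ?J \<epsilon>" by (simp add: int)
  qed (use assms in auto)
  then have "(?J \<longlongrightarrow> ?L) (at_right 0)"
    by (rule Lim_transform_eventually[OF tendsto_const])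
  then have "Lim (at_right 0) ?J = ?L" by (intro tendsto_Lim) auto
  then show ?thesis unfolding finite_hilbert_transform_def .
qed

section \<open>Norm and weak topology\<close>

text \<open>
  In a Hausdorff space compact sets are closed. The weak topology lives on representatives and is not
  Hausdorff, and the closure of a compact set adds all functions that agree with one of its members almost
  everywhere. Regularity suffices for the closure to stay compact: each point of \<open>K\<close> has a closed
  neighbourhood inside a member of the cover, and finitely many of these have a closed union that
  contains \<open>K\<close>.
\<close>

lemma compactin_closure_of_regular:
  assumes "regular_space \<tau>" "compactin \<tau> K"
  shows "compactin \<tau> (\<tau> closure_of K)"
  unfolding compactin_def
proof (intro conjI allI impI)
  show "\<tau> closure_of K \<subseteq> topspace \<tau>" by (rule closure_of_subset_topspace)
  fix \<U> assume "Ball \<U> (openin \<tau>) \<and> \<tau> closure_of K \<subseteq> \<Union> \<U>"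
  then have \<U>: "\<And>U. U \<in> \<U> \<Longrightarrow> openin \<tau> U" and cover: "\<tau> closure_of K \<subseteq> \<Union> \<U>"
    by auto
  have KX: "K \<subseteq> topspace \<tau>" using compactin_subset_topspace[OF assms(2)] .
  have base: "neighbourhood_base_of (closedin \<tau>) \<tau>"
    using assms(1) neighbourhood_base_of_closedin by blast
  have "\<exists>G C W. openin \<tau> G \<and> closedin \<tau> C \<and> k \<in> G \<and> G \<subseteq> C \<and> C \<subseteq> W \<and> W \<in> \<U>" if k: "k \<in> K" for k
  proof -
    have "k \<in> \<Union> \<U>" using closure_of_subset[OF KX] cover k by auto
    then obtain W where W: "W \<in> \<U>" "k \<in> W" by auto
    then obtain G C where "openin \<tau> G" "closedin \<tau> C" "k \<in> G" "G \<subseteq> C" "C \<subseteq> W"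
      using base \<U> unfolding neighbourhood_base_of by metis
    then show ?thesis using W by blast
  qed
  then have "\<forall>k\<in>K. \<exists>G C W. openin \<tau> G \<and> closedin \<tau> C \<and> k \<in> G \<and> G \<subseteq> C \<and> C \<subseteq> W \<and> W \<in> \<U>"
    by blast
  then obtain G C W where "\<forall>k\<in>K. openin \<tau> (G k) \<and> closedin \<tau> (C k) \<and> k \<in> G k \<and> G k \<subseteq> C k \<and>
      C k \<subseteq> W k \<and> W k \<in> \<U>"
    unfolding bchoice_iff by blast
  then have OCW: "\<And>k. k \<in> K \<Longrightarrow> openin \<tau> (G k)" "\<And>k. k \<in> K \<Longrightarrow> closedin \<tau> (C k)"
    "\<And>k. k \<in> K \<Longrightarrow> k \<in> G k" "\<And>k. k \<in> K \<Longrightarrow> G k \<subseteq> C k" "\<And>k. k \<in> K \<Longrightarrow> C k \<subseteq> W k"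
    "\<And>k. k \<in> K \<Longrightarrow> W k \<in> \<U>"
    by blast+
  obtain \<F> where \<F>: "finite \<F>" "\<F> \<subseteq> G ` K" "K \<subseteq> \<Union>\<F>"
    using compactinD[OF assms(2), of "G ` K"] OCW(1,3) by blast
  then obtain F where F: "finite F" "F \<subseteq> K" "\<F> = G ` F"
    by (meson finite_subset_image)
  have "closedin \<tau> (\<Union>k\<in>F. C k)"
    using F OCW(2) by (intro closedin_Union) auto
  moreover have "K \<subseteq> (\<Union>k\<in>F. C k)" using \<F>(3) F OCW(4) by blast
  ultimately have "\<tau> closure_of K \<subseteq> (\<Union>k\<in>F. C k)" by (rule closure_of_minimal[rotated])
  also have "\<dots> \<subseteq> \<Union> (W ` F)" using OCW(5) F by blast
  finally show "\<exists>\<F>. finite \<F> \<and> \<F> \<subseteq> \<U> \<and> \<tau> closure_of K \<subseteq> \<Union> \<F>"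
    using F OCW(6) by (intro exI[of _ "W ` F"]) auto
qed

context bfs
begin

lemma topspace_norm_topology: "topspace (norm_topology X N) = X"
  unfolding norm_topology_def topology_generated_by_topspace
proof (intro equalityI subsetI)
  fix f assume f: "f \<in> X"
  show "f \<in> \<Union> {{g \<in> X. N (\<lambda>x. g x - f x) < e} |f e. f \<in> X \<and> 0 < e}"
  proof (rule UnionI)
    show "f \<in> {g \<in> X. N (\<lambda>x. g x - f x) < 1}" using f by (simp add: N_zero)
    show "{g \<in> X. N (\<lambda>x. g x - f x) < 1} \<in> {{g \<in> X. N (\<lambda>x. g x - f x) < e} |f e. f \<in> X \<and> 0 < e}"
      using f zero_less_one by blast
  qed
qed auto

lemma openin_norm_ball:
  "f \<in> X \<Longrightarrow> 0 < e \<Longrightarrow> openin (norm_topology X N) {g \<in> X. N (\<lambda>x. g x - f x) < e}"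
  unfolding norm_topology_def by (rule topology_generated_by_Basis) blast

lemma zero_functional: "bounded_linear_functional X N (\<lambda>f. 0)"
  unfolding bounded_linear_functional_def by (auto intro: exI[of _ 0])

lemma topspace_weak_topology: "topspace (weak_topology_on X N) = X"
  unfolding weak_topology_on_def topology_generated_by_topspace
  using zero_functional by (auto intro!: exI[of _ X] exI[of _ UNIV])

lemma openin_weak_basic:
  "bounded_linear_functional X N \<phi> \<Longrightarrow> open U \<Longrightarrow> openin (weak_topology_on X N) {f \<in> X. \<phi> f \<in> U}"
  unfolding weak_topology_on_def by (rule topology_generated_by_Basis) blast

text \<open>
  Bounded functionals pull closed discs back to closed neighbourhoods, and the existence of closed
  neighbourhoods inside an open set survives finite intersections and arbitrary unions of open sets.
\<close>

lemma regular_weak_topology: "regular_space (weak_topology_on X N)"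
proof -
  let ?\<tau> = "weak_topology_on X N"
  let ?B = "{{f \<in> X. \<phi> f \<in> U} | \<phi> U. bounded_linear_functional X N \<phi> \<and> open U}"
  have "\<exists>U V. openin ?\<tau> U \<and> closedin ?\<tau> V \<and> a \<in> U \<and> U \<subseteq> V \<and> V \<subseteq> W"
    if "generate_topology_on ?B W" "a \<in> W" for W a
    using that
  proof (induction arbitrary: a rule: generate_topology_on.induct)
    case Empty
    then show ?case by simp
  next
    case (Int W1 W2)
    obtain U1 V1 where 1: "openin ?\<tau> U1" "closedin ?\<tau> V1" "a \<in> U1" "U1 \<subseteq> V1" "V1 \<subseteq> W1"
      using Int.IH(1)[of a] Int.prems by blast
    obtain U2 V2 where 2: "openin ?\<tau> U2" "closedin ?\<tau> V2" "a \<in> U2" "U2 \<subseteq> V2" "V2 \<subseteq> W2"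
      using Int.IH(2)[of a] Int.prems by blast
    show ?case
      using 1 2 by (intro exI[of _ "U1 \<inter> U2"] exI[of _ "V1 \<inter> V2"] conjI openin_Int closedin_Int) auto
  next
    case (UN \<K>)
    then obtain W where "W \<in> \<K>" "a \<in> W" by blast
    then show ?case using UN.IH[of W a] by blast
  next
    case (Basis W)
    then obtain \<phi> G where \<phi>: "bounded_linear_functional X N \<phi>" "open G" and W: "W = {f \<in> X. \<phi> f \<in> G}"
      by blast
    then obtain e where e: "0 < e" "cball (\<phi> a) e \<subseteq> G"
      using Basis open_contains_cball by blast
    let ?U = "{f \<in> X. \<phi> f \<in> ball (\<phi> a) e}" and ?V = "{f \<in> X. \<phi> f \<in> cball (\<phi> a) e}"
    have "openin ?\<tau> ?U" by (rule openin_weak_basic[OF \<phi>(1)]) simp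
    moreover have "closedin ?\<tau> ?V"
    proof -
      have "openin ?\<tau> {f \<in> X. \<phi> f \<in> - cball (\<phi> a) e}"
        by (rule openin_weak_basic[OF \<phi>(1)]) (simp add: open_Compl)
      moreover have "X - ?V = {f \<in> X. \<phi> f \<in> - cball (\<phi> a) e}" by auto
      ultimately show ?thesis unfolding closedin_def topspace_weak_topology by auto
    qed
    moreover have "a \<in> ?U" "?U \<subseteq> ?V" "?V \<subseteq> W"
      using Basis W e by auto
    ultimately show ?case by blast
  qed
  then have "neighbourhood_base_of (closedin ?\<tau>) ?\<tau>"
    unfolding neighbourhood_base_of weak_topology_on_def openin_topology_generated_by_iff by blast
  then show ?thesis using neighbourhood_base_of_closedin by blast
qed

end

section \<open>The finite Hilbert transform on a rearrangement invariant space\<close>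

text \<open>
  A countable family suffices, so the exceptional null sets of the majorant can be united. At every remaining
  \<open>x\<close> the value \<open>h x\<close> would bound \<open>\<bar>ln (x - b)\<bar>\<close> as rational \<open>b\<close>
  approach \<open>x\<close> from below.
\<close>

lemma (in bfs) not_order_bounded_hilbert: "\<not> order_bounded_operator X finite_hilbert_transform"
proof
  assume ob: "order_bounded_operator X finite_hilbert_transform"
  define Q where "Q = {b \<in> \<rat>. -1 < b \<and> b < (1::real)}"
  define W :: "(real \<Rightarrow> complex) set" where "W = (\<lambda>b. indicator {-1<..<b}) ` Q"
  have "W \<subseteq> X"
  proof
    fix f assume "f \<in> W"
    then obtain b where b: "b \<in> Q" "f = indicator {-1<..<b}" unfolding W_def by blast
    then have "{-1<..<b} \<in> sets \<mu>" by (auto simp: sets_\<mu>_iff Q_def)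
    then show "f \<in> X" unfolding b(2) by (rule X_indicator)
  qed
  moreover have "order_bounded X W"
    unfolding order_bounded_def
  proof (intro exI[of _ "\<lambda>x. 1"] conjI ballI AE_I2)
    show "(\<lambda>x. complex_of_real 1) \<in> X" by (rule X_const)
    show "cmod (f x) \<le> 1" if "f \<in> W" for f x
      using that unfolding W_def by (auto simp: indicator_def)
  qed simp
  ultimately have "order_bounded X (finite_hilbert_transform ` W)"
    using ob unfolding order_bounded_operator_def by blast
  then obtain h :: "real \<Rightarrow> real" where
    h: "\<And>f. f \<in> W \<Longrightarrow> AE x in \<mu>. cmod (finite_hilbert_transform f x) \<le> h x"
    unfolding order_bounded_def by blast
  have "countable Q"
    unfolding Q_def by (rule countable_subset[OF _ countable_rat]) auto
  then have "AE x in \<mu>. \<forall>b\<in>Q. cmod (finite_hilbert_transform (indicator {-1<..<b}) x) \<le> h x"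
    by (rule AE_ball_countable'[rotated]) (rule h, unfold W_def, erule imageI)
  then have "AE x in \<mu>. False"
    using AE_space
  proof eventually_elim
    case (elim x)
    then have x: "-1 < x" "x < 1" by auto
    define c where "c = exp (ln (x + 1) - pi * h x)"
    have "max (-1) (x - c) < x" using x by (simp add: c_def)
    then obtain b where b: "b \<in> \<rat>" "max (-1) (x - c) < b" "b < x"
      using Rats_dense_in_real by blast
    then have "b \<in> Q" using x by (auto simp: Q_def)
    then have "cmod (finite_hilbert_transform (indicator {-1<..<b}) x) \<le> h x"
      using elim by blast
    moreover have "finite_hilbert_transform (indicator {-1<..<b}) x
        = complex_of_real ((ln (x - b) - ln (x + 1)) / pi)"
      by (rule finite_hilbert_transform_indicator) (use b x in auto)
    ultimately have "\<bar>(ln (x - b) - ln (x + 1)) / pi\<bar> \<le> h x"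
      by (metis norm_of_real)
    then have "- h x \<le> (ln (x - b) - ln (x + 1)) / pi" by linarith
    then have "- h x * pi \<le> ln (x - b) - ln (x + 1)"
      by (simp only: pos_le_divide_eq[OF pi_gt_zero])
    then have "ln (x + 1) - pi * h x \<le> ln (x - b)"
      by (simp add: mult.commute)
    then have "c \<le> exp (ln (x - b))" unfolding c_def by simp
    then show False using b by simp
  qed
  then show False using AE_\<mu>_False by simp
qed

context ri_space
begin

text \<open>
  A weakly null sequence together with its limit 0 is compact, and the weak topology is regular.
\<close>

lemma trig_fun_relatively_weakly_compact:
  assumes boyd: "0 < lower_boyd_index X N" and e: "e = sin \<or> e = cos"
  shows "relatively_compactin (weak_topology_on X N) (trig_fun e ` {0<..})"
proof -
  let ?\<tau> = "weak_topology_on X N"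
  let ?B = "{{f \<in> X. \<phi> f \<in> U} | \<phi> U. bounded_linear_functional X N \<phi> \<and> open U}"
  let ?K = "insert (\<lambda>x. 0) (trig_fun e ` {0<..})"
  have conv: "finite {n. 0 < n \<and> trig_fun e n \<notin> U}"
    if "generate_topology_on ?B U" "(\<lambda>x. 0) \<in> U" for U
    using that
  proof (induction rule: generate_topology_on.induct)
    case Empty
    then show ?case by simp
  next
    case (Int U V)
    then have "finite ({n. 0 < n \<and> trig_fun e n \<notin> U} \<union> {n. 0 < n \<and> trig_fun e n \<notin> V})" by simp
    then show ?case by (rule rev_finite_subset) auto
  next
    case (UN \<K>)
    then obtain U where U: "U \<in> \<K>" "(\<lambda>x. 0) \<in> U" by blast
    show ?case by (rule finite_subset[OF _ UN.IH[OF U]]) (use U in auto)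
  next
    case (Basis U)
    then obtain \<phi> G where \<phi>: "bounded_linear_functional X N \<phi>" "open G" and U: "U = {f \<in> X. \<phi> f \<in> G}"
      by blast
    have "\<And>c f. f \<in> X \<Longrightarrow> \<phi> (\<lambda>x. c * f x) = c * \<phi> f"
      using \<phi>(1) unfolding bounded_linear_functional_def by blast
    from this[OF X_zero, of 0] have "\<phi> (\<lambda>x. 0) = 0" by simp
    then have "0 \<in> G" using Basis(2) unfolding U by simp
    then obtain \<delta> where \<delta>: "0 < \<delta>" "ball 0 \<delta> \<subseteq> G" using \<phi>(2) open_contains_ball by blast
    have "\<delta> \<le> cmod (\<phi> (trig_fun e n))" if "trig_fun e n \<notin> U" for n
    proof -
      have "\<phi> (trig_fun e n) \<notin> G" using that trig_fun_X[OF e, of n] unfolding U by blast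
      then have "\<phi> (trig_fun e n) \<notin> ball 0 \<delta>" using \<delta>(2) by blast
      then show ?thesis by simp
    qed
    then have "{n. 0 < n \<and> trig_fun e n \<notin> U} \<subseteq> {n. 0 < n \<and> \<delta> \<le> cmod (\<phi> (trig_fun e n))}"
      by blast
    then show ?case
      by (rule finite_subset) (rule trig_fun_weakly_null[OF boyd \<delta>(1) e \<phi>(1)])
  qed
  have KX: "?K \<subseteq> X" using X_zero trig_fun_X[OF e] by auto
  have "compactin ?\<tau> ?K"
    unfolding compactin_def topspace_weak_topology
  proof (intro conjI allI impI KX)
    fix \<U> assume "Ball \<U> (openin ?\<tau>) \<and> ?K \<subseteq> \<Union> \<U>"
    then have \<U>: "\<And>U. U \<in> \<U> \<Longrightarrow> openin ?\<tau> U" and cover: "?K \<subseteq> \<Union> \<U>" by auto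
    then obtain U0 where U0: "U0 \<in> \<U>" "(\<lambda>x. 0) \<in> U0" by auto
    define E where "E = {n. 0 < n \<and> trig_fun e n \<notin> U0}"
    have "finite E"
      unfolding E_def using \<U>[OF U0(1)]
      unfolding weak_topology_on_def openin_topology_generated_by_iff by (rule conv[OF _ U0(2)])
    have "\<forall>n\<in>E. \<exists>U\<in>\<U>. trig_fun e n \<in> U" using cover by (auto simp: E_def)
    then obtain V where V: "\<And>n. n \<in> E \<Longrightarrow> V n \<in> \<U> \<and> trig_fun e n \<in> V n" by metis
    have "?K \<subseteq> \<Union> (insert U0 (V ` E))"
    proof
      fix f assume "f \<in> ?K"
      then consider "f = (\<lambda>x. 0)" | n where "0 < n" "f = trig_fun e n" by auto
      then show "f \<in> \<Union> (insert U0 (V ` E))"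
      proof cases
        case 1
        then show ?thesis using U0 by simp
      next
        case 2
        then show ?thesis using V[of n] by (cases "n \<in> E") (auto simp: E_def)
      qed
    qed
    then show "\<exists>\<F>. finite \<F> \<and> \<F> \<subseteq> \<U> \<and> ?K \<subseteq> \<Union> \<F>"
      using \<open>finite E\<close> U0 V by (intro exI[of _ "insert U0 (V ` E)"]) auto
  qed
  then have "compactin ?\<tau> (?\<tau> closure_of ?K)"
    by (rule compactin_closure_of_regular[OF regular_weak_topology])
  moreover have "?\<tau> closure_of (trig_fun e ` {0<..}) \<subseteq> ?\<tau> closure_of ?K"
    by (rule closure_of_mono) blast
  ultimately show ?thesis
    unfolding relatively_compactin_def by (rule closed_compactin) (rule closedin_closure_of)
qed

text \<open>
  Suppose that the \<open>\<epsilon>\<close>-balls around a finite set \<open>F\<close> cover all functions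
  \<open>g n = cos (n * arccos x)\<close>. One ball contains infinitely many of them. Each such \<open>g n\<close> is
  within \<open>2 * \<epsilon>\<close> of every average of the others, and long averages have norm below
  \<open>\<epsilon>\<close>, so the norm of \<open>g n\<close> is at most \<open>3 * \<epsilon>\<close>. Averaging
  \<open>1 = 2 * (g n)\<^sup>2 - g (2 * n)\<close> and using \<open>(g n)\<^sup>2 \<le> \<bar>g n\<bar>\<close> bounds the norm of 1 by
  \<open>6 * \<epsilon>\<close> for the squares plus less than \<open>\<epsilon>\<close> for the rest, which is why an eighth
  of that norm is chosen for \<open>\<epsilon>\<close>.
\<close>

lemma cos_not_totally_bounded:
  assumes boyd: "0 < lower_boyd_index X N"
  obtains \<epsilon> where "0 < \<epsilon>"
    "\<And>F. finite F \<Longrightarrow> F \<subseteq> X \<Longrightarrow> \<exists>n>0. \<forall>c\<in>F. \<epsilon> \<le> N (\<lambda>x. trig_fun cos n x - c x)"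
proof (rule that[of "N (\<lambda>x. 1) / 8"])
  let ?\<epsilon> = "N (\<lambda>x. 1) / 8"
  let ?g = "trig_fun cos"
  show \<epsilon>: "0 < ?\<epsilon>" using N_one_pos by simp
  have gX: "?g n \<in> X" for n by (rule trig_fun_X) simp
  fix F assume F: "finite F" "F \<subseteq> X"
  show "\<exists>n>0. \<forall>c\<in>F. ?\<epsilon> \<le> N (\<lambda>x. ?g n x - c x)"
  proof (rule ccontr)
    assume "\<not> ?thesis"
    then have "\<forall>n\<in>{0<..}. \<exists>c\<in>F. N (\<lambda>x. ?g n x - c x) < ?\<epsilon>"
      by (meson greaterThan_iff not_le)
    from pigeonhole_infinite_rel[OF infinite_Ioi F(1) this]
    obtain c where c: "c \<in> F" and inf: "infinite {n\<in>{0<..}. N (\<lambda>x. ?g n x - c x) < ?\<epsilon>}"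
      by (rule bexE)
    define S where "S = {n\<in>{0<..}. N (\<lambda>x. ?g n x - c x) < ?\<epsilon>}"
    have cX: "c \<in> X" using c F by auto
    have close: "N (\<lambda>x. ?g n x - ?g m x) \<le> 2 * ?\<epsilon>" if "n \<in> S" "m \<in> S" for n m
    proof -
      have "N (\<lambda>x. (?g n x - c x) - (?g m x - c x)) \<le> N (\<lambda>x. ?g n x - c x) + N (\<lambda>x. ?g m x - c x)"
        by (rule N_diff[OF X_diff[OF gX cX] X_diff[OF gX cX]])
      then show ?thesis using that by (simp add: S_def)
    qed
    obtain M :: nat where M: "0 < M"
      "\<And>K c. finite K \<Longrightarrow> 0 \<notin> K \<Longrightarrow> M \<le> card K \<Longrightarrow> (\<And>k. k \<in> K \<Longrightarrow> cmod (c k) \<le> 1) \<Longrightarrow>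
         N (\<lambda>x. complex_of_real (1 / card K) * (\<Sum>k\<in>K. c k * ?g k x)) < ?\<epsilon>"
      by (rule trig_average_small[OF boyd \<epsilon>, of cos]) blast+
    obtain K where K: "finite K" "card K = M" "K \<subseteq> S"
      using infinite_arbitrarily_large[OF inf] unfolding S_def by blast
    have K0: "K \<noteq> {}" "0 \<notin> K" using K M(1) by (auto simp: S_def)
    define avg where "avg u x = complex_of_real (1 / card K) * (\<Sum>k\<in>K. u k x)"
      for u :: "nat \<Rightarrow> real \<Rightarrow> complex" and x
    have avg_eq: "avg u = (\<lambda>x. complex_of_real (1 / card K) * (\<Sum>k\<in>K. u k x))" for u
      by (rule ext) (rule avg_def)
    have avgX: "avg u \<in> X" if "\<And>k. u k \<in> X" for u
      unfolding avg_eq by (rule X_scale, rule X_sum, rule that)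
    have avg_le: "N (avg u) \<le> B" if "\<And>k. u k \<in> X" "\<And>k. k \<in> K \<Longrightarrow> N (u k) \<le> B" for u B
      unfolding avg_eq by (rule N_average_le[OF K(1) K0(1) that])
    have avg_const: "avg (\<lambda>k x. f x) x = f x" for f x
      using K(1) K0(1) by (simp add: avg_def)
    have avg_diff: "avg (\<lambda>k x. u k x - v k x) x = avg u x - avg v x" for u v x
      unfolding avg_def sum_subtractf by (rule right_diff_distrib)
    have avg_small: "N (avg ?g) < ?\<epsilon>"
      using M(2)[of K "\<lambda>k. 1"] K K0 unfolding avg_eq by simp
    have small: "N (?g n) \<le> 3 * ?\<epsilon>" if n: "n \<in> S" for n
    proof -
      define d where "d k x = ?g n x - ?g k x" for k x
      have dX: "d k \<in> X" for k unfolding d_def[abs_def] by (rule X_diff[OF gX gX])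
      have dN: "N (d k) \<le> 2 * ?\<epsilon>" if "k \<in> K" for k
        unfolding d_def[abs_def] by (rule close[OF n]) (use that K in blast)
      have "avg d x + avg ?g x = ?g n x" for x
        using avg_diff[of "\<lambda>k. ?g n" ?g x] avg_const[of "?g n" x] by (simp add: d_def[abs_def])
      then have "N (?g n) = N (\<lambda>x. avg d x + avg ?g x)" by simp
      also have "\<dots> \<le> N (avg d) + N (avg ?g)"
        by (rule N_triangle[OF avgX[OF dX] avgX[OF gX]])
      also have "N (avg d) \<le> 2 * ?\<epsilon>" by (rule avg_le[OF dX dN])
      finally show ?thesis using avg_small by simp
    qed
    have sqX: "(\<lambda>x. ?g k x * ?g k x) \<in> X"
      and sqN: "N (\<lambda>x. ?g k x * ?g k x) \<le> N (?g k)" for k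
    proof -
      have [measurable]: "?g k \<in> L0" by (rule X_L0[OF gX])
      have le: "cmod (?g k x * ?g k x) \<le> cmod (?g k x)" for x
        using trig_fun_bound[of cos k x] by (simp add: norm_mult mult_left_le)
      show X1: "(\<lambda>x. ?g k x * ?g k x) \<in> X"
        by (rule X_solid[OF gX[of k]]) (measurable, rule AE_I2, rule le)
      show "N (\<lambda>x. ?g k x * ?g k x) \<le> N (?g k)"
        by (rule N_mono[OF gX X1]) (rule AE_I2, rule le)
    qed
    have double: "2 * (?g k x * ?g k x) - ?g (2 * k) x = 1" for k x
    proof -
      have "cos (2 * (k * arccos x)) = 2 * (cos (k * arccos x))\<^sup>2 - 1" by (rule cos_double_cos)
      then have "cos (real (2 * k) * arccos x) = 2 * (cos (k * arccos x) * cos (k * arccos x)) - 1"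
        by (simp add: power2_eq_square mult.assoc)
      then show ?thesis by (simp add: trig_fun_def)
    qed
    \<comment> \<open>The doubled frequencies run over a set of the same size, so their average is small as well.\<close>
    have inj: "inj_on ((*) 2) K" by (auto intro: inj_onI)
    have avg2: "N (avg (\<lambda>k. ?g (2 * k))) < ?\<epsilon>"
      using M(2)[of "(*) 2 ` K" "\<lambda>k. 1"] K K0 unfolding avg_eq
      by (simp add: card_image[OF inj] sum.reindex[OF inj] image_iff)
    define q where "q k x = 2 * (?g k x * ?g k x)" for k x
    have qX: "q k \<in> X" for k unfolding q_def[abs_def] by (rule X_scale[OF sqX])
    have qN: "N (q k) \<le> 6 * ?\<epsilon>" if "k \<in> K" for k
    proof -
      have "k \<in> S" using that K by blast
      have "N (q k) = 2 * N (\<lambda>x. ?g k x * ?g k x)"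
        unfolding q_def[abs_def] using N_scale[OF sqX, of 2] by simp
      then show ?thesis using sqN[of k] small[OF \<open>k \<in> S\<close>] by linarith
    qed
    have "avg q x - avg (\<lambda>k. ?g (2 * k)) x = 1" for x
      using avg_diff[of q "\<lambda>k. ?g (2 * k)" x] avg_const[of "\<lambda>x. 1" x]
      unfolding q_def[abs_def] double by simp
    then have "N (\<lambda>x. 1) = N (\<lambda>x. avg q x - avg (\<lambda>k. ?g (2 * k)) x)" by simp
    also have "\<dots> \<le> N (avg q) + N (avg (\<lambda>k. ?g (2 * k)))"
      by (rule N_diff[OF avgX[OF qX] avgX[OF gX]])
    also have "N (avg q) \<le> 6 * ?\<epsilon>" by (rule avg_le[OF qX qN])
    finally show False using avg2 \<epsilon> by linarith
  qed
qed

text \<open>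
  The transforms agree almost everywhere with elements of \<open>X\<close>, hence belong to \<open>X\<close>, and a
  compact closure would be covered by finitely many balls of every radius.
\<close>

lemma hilbert_image_not_relatively_compact:
  assumes boyd: "0 < lower_boyd_index X N"
  shows "\<not> relatively_compactin (norm_topology X N) (finite_hilbert_transform ` trig_fun sin ` {0<..})"
    (is "\<not> relatively_compactin ?\<tau> ?W")
proof
  assume comp: "relatively_compactin ?\<tau> ?W"
  obtain \<epsilon> where \<epsilon>: "0 < \<epsilon>"
    and far: "\<And>F. finite F \<Longrightarrow> F \<subseteq> X \<Longrightarrow> \<exists>n>0. \<forall>c\<in>F. \<epsilon> \<le> N (\<lambda>x. trig_fun cos n x - c x)"
    using cos_not_totally_bounded[OF boyd] by blast
  let ?T = "\<lambda>n. finite_hilbert_transform (trig_fun sin n)"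
  have T: "AE x in \<mu>. ?T n x = - trig_fun cos n x" if "0 < n" for n
    by (rule AE_\<mu>_I) (use that in \<open>simp add: finite_hilbert_transform_sin_arccos\<close>)
  have gX: "(\<lambda>x. - trig_fun cos n x) \<in> X" for n
    using X_scale[OF trig_fun_X[of cos n], of "-1"] by simp
  have TX: "?T n \<in> X" if "0 < n" for n
  proof (rule X_cong(1)[OF gX _ T[OF that]])
    have "?T n \<in> L0 \<longleftrightarrow> (\<lambda>x. - trig_fun cos n x) \<in> L0"
      by (rule measurable_cong) (use that in \<open>simp add: finite_hilbert_transform_sin_arccos\<close>)
    then show "?T n \<in> L0" using X_L0[OF gX] by simp
  qed
  let ?ball = "\<lambda>c. {g \<in> X. N (\<lambda>x. g x - c x) < \<epsilon>}"
  let ?C = "?\<tau> closure_of ?W"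
  have CX: "?C \<subseteq> X" using closure_of_subset_topspace[of ?\<tau> ?W] by (simp add: topspace_norm_topology)
  have "\<exists>\<F>. finite \<F> \<and> \<F> \<subseteq> ?ball ` ?C \<and> ?C \<subseteq> \<Union> \<F>"
  proof (rule compactinD)
    show "compactin ?\<tau> ?C" using comp by (simp add: relatively_compactin_def)
    show "openin ?\<tau> U" if "U \<in> ?ball ` ?C" for U
      using that CX \<epsilon> openin_norm_ball by auto
    show "?C \<subseteq> \<Union> (?ball ` ?C)"
      using CX \<epsilon> by (force simp: N_zero)
  qed
  then obtain F0 where F0: "finite F0" "F0 \<subseteq> ?C" "?C \<subseteq> \<Union> (?ball ` F0)"
    by (metis (no_types, lifting) finite_subset_image)
  let ?F = "(\<lambda>c x. - c x) ` F0"
  have "?F \<subseteq> X"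
    using F0(2) CX X_scale[of _ "-1"] by auto
  then obtain n where n: "0 < n" and far_n: "\<And>c. c \<in> F0 \<Longrightarrow> \<epsilon> \<le> N (\<lambda>x. trig_fun cos n x - (- c x))"
    using far[of ?F] F0(1) by auto
  have "?T n \<in> ?C"
    by (rule closure_of_subset[THEN subsetD]) (use TX n in \<open>auto simp: topspace_norm_topology\<close>)
  then obtain c where c: "c \<in> F0" "N (\<lambda>x. ?T n x - c x) < \<epsilon>" using F0(3) by auto
  then have cX: "c \<in> X" using F0(2) CX by auto
  have "N (\<lambda>x. ?T n x - c x) = N (\<lambda>x. - trig_fun cos n x - c x)"
    by (rule X_cong(2)[OF X_diff[OF gX cX] X_L0[OF X_diff[OF TX[OF n] cX]]])
       (use T[OF n] in \<open>eventually_elim, simp\<close>)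
  also have "\<dots> = N (\<lambda>x. - c x - trig_fun cos n x)"
    by (rule arg_cong[where f = N]) auto
  also have "\<dots> = N (\<lambda>x. trig_fun cos n x - (- c x))"
    using N_minus_commute[of "\<lambda>x. - c x" "trig_fun cos n"] X_scale[OF cX, of "-1"]
      trig_fun_X[of cos n] by simp
  finally show False using far_n[OF c(1)] c(2) by linarith
qed

end

theorem corollary3p4:
  fixes X :: "(real \<Rightarrow> complex) set" and N :: "(real \<Rightarrow> complex) \<Rightarrow> real"
  assumes "rearrangement_invariant X N"
    and "0 < lower_boyd_index X N"
    and "lower_boyd_index X N \<le> upper_boyd_index X N"
    and "upper_boyd_index X N < 1"
  shows "\<not> completely_continuous X N finite_hilbert_transform
       \<and> \<not> order_bounded_operator X finite_hilbert_transform
       \<and> \<not> compact_operator X N finite_hilbert_transform"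
proof -
  interpret ri_space X N by unfold_locales (rule assms(1))
  let ?W = "trig_fun sin ` {0<..}"
  have WX: "?W \<subseteq> X" using trig_fun_X[of sin] by auto
  have "N f \<le> 1 * N (\<lambda>x. 1)" if "f \<in> ?W" for f
    using that WX by (intro N_const_bound) (auto simp: trig_fun_bound)
  then have "\<exists>B. \<forall>f\<in>?W. N f \<le> B" by blast
  moreover have "relatively_compactin (weak_topology_on X N) ?W"
    by (rule trig_fun_relatively_weakly_compact[OF assms(2)]) simp
  moreover have "\<not> relatively_compactin (norm_topology X N) (finite_hilbert_transform ` ?W)"
    by (rule hilbert_image_not_relatively_compact[OF assms(2)])
  ultimately show ?thesis
    using WX not_order_bounded_hilbert
    unfolding completely_continuous_def compact_operator_def by blast
qed

end
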